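(* Let $X$ be the subshift obtained from the marker construction described in the context (it has topological entropy dimension $1/2$), and $\mu$ its unique shift-invariant probability measure. For $x\in X$ and $n \in \mathbb{N}$ let $P_n(x) = \{y \in X : y_i = x_i \text{ for } 0\le i<n\}$. Then: (1) For $\mu$-a.e. $x \in X$, the quantity $\limsup_{n\to\infty} -\frac{1}{n^{\beta}}\log\mu(P_n(x))$, as a function of $\beta>0$, has critical value $1/2$. (2) There is a set $\hat X \subset X$ with $\mu(\hat X) = 1$ such that for every $\tau \in [0,1/2]$ there is an increasing sequence $(n_j)_{j\in\mathbb{N}}$ of positive integers such that for each $x \in \hat X$, the quantity $\lim_{j\to\infty} -\frac{1}{(n_j)^{\beta}}\log\mu(P_{n_j}(x))$, as a function of $\beta > 0$, has critical value $\tau$.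
   Context: Marker construction. Let $l_1$ be a sufficiently large perfect square and $N_1 = 2^{\sqrt{l_1}}$. Let $\mathcal{C}_1$ be a set of $N_1$ binary words of length $l_1$, each beginning with $001$, such that the word $00$ occurs in each element of $\mathcal{C}_1$ only as its prefix. Inductively, given a set $\mathcal{C}_j$ of $N_j$ distinct words of length $l_j$ with an ordering $\mathcal{C}_j = \{u_1^{(j)},\dots,u_{N_j}^{(j)}\}$, let $P_j = \{2\}\cup\{i^2 : 2 \le i \le \lfloor\sqrt{N_j}\rfloor\}$, and let $\mathcal{C}_{j+1}$ be the set of all words $u^{(j)}_{\pi(1)}\cdots u^{(j)}_{\pi(N_j)}$ where $\pi$ ranges over permutations of $\{1,\dots,N_j\}$ fixing every element outside $P_j$. Thus $N_{j+1} = (\lfloor\sqrt{N_j}\rfloor)!$, $l_{j+1} = l_j N_j$. The ordering of $\mathcal{C}_{j+1}$ is arbitrary except that its first element is $u_1^{(j)}u_2^{(j)}\cdots u_{N_j}^{(j)}$. $X \subset \{0,1\}^{\mathbb{Z}}$ is the set of bi-infinite sequences each finite subword of which is a subword of some word in $\bigcup_j \mathcal{C}_j$; it is strictly ergodic. Critical value: for a family of quantities $F(\beta)\in[0,\infty]$ indexed by $\beta>0$ (here a limsup or limit of $a_n/n^\beta$ with $a_n\ge 0$), we say $F$ has critical value $c$ if $F(\beta) = \infty$ for all $0<\beta<c$ and $F(\beta) = 0$ for all $\beta > c$ (for $c=0$: $F(\beta)=0$ for all $\beta>0$). *)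

theory Defs
  imports "HOL-Probability.Probability" "HOL-Library.Sublist" "HOL-Combinatorics.Permutations"
begin

text \<open>Binary words are lists over {0,1} (type nat list); points of the subshift are
  bi-infinite sequences int => nat.  The ordered set C_j is the list C j (j >= 1),
  whose k-th element (1-based) is u_k^(j), i.e. C j ! (k - 1).\<close>

definition marker_P :: "nat \<Rightarrow> nat set" where
  "marker_P N = {2} \<union> {i ^ 2 | i. 2 \<le> i \<and> i \<le> nat \<lfloor>sqrt (real N)\<rfloor>}"

definition marker_construction :: "nat \<Rightarrow> (nat \<Rightarrow> nat list list) \<Rightarrow> bool" where
  "marker_construction l1 C \<longleftrightarrow>
     (\<exists>s. l1 = s ^ 2 \<and> length (C 1) = 2 ^ s) \<and>
     distinct (C 1) \<and>
     (\<forall>w \<in> set (C 1). length w = l1 \<and> set w \<subseteq> {0, 1} \<and> take 3 w = [0, 0, 1] \<and>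
        (\<forall>k. Suc k < length w \<and> w ! k = 0 \<and> w ! Suc k = 0 \<longrightarrow> k = 0)) \<and>
     (\<forall>j \<ge> 1.
        distinct (C (Suc j)) \<and>
        set (C (Suc j)) =
          {concat (map (\<lambda>i. C j ! (\<pi> i - 1)) [1..<length (C j) + 1]) | \<pi>.
              \<pi> permutes marker_P (length (C j))} \<and>
        hd (C (Suc j)) = concat (C j))"

definition marker_shift :: "(nat \<Rightarrow> nat list list) \<Rightarrow> (int \<Rightarrow> nat) set" where
  "marker_shift C = {x. \<forall>(a::int) (n::nat). \<exists>j \<ge> 1. \<exists>w \<in> set (C j).
       sublist (map (\<lambda>k. x (a + int k)) [0..<n]) w}"

definition shift_map :: "(int \<Rightarrow> nat) \<Rightarrow> (int \<Rightarrow> nat)" where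
  "shift_map x = (\<lambda>i. x (i + 1))"

definition cyl :: "(int \<Rightarrow> nat) set \<Rightarrow> nat \<Rightarrow> (int \<Rightarrow> nat) \<Rightarrow> (int \<Rightarrow> nat) set" where
  "cyl X n x = {y \<in> X. \<forall>i < n. y (int i) = x (int i)}"

definition has_critical_value :: "(real \<Rightarrow> ereal) \<Rightarrow> real \<Rightarrow> bool" where
  "has_critical_value F c \<longleftrightarrow>
     (\<forall>\<beta>. 0 < \<beta> \<and> \<beta> < c \<longrightarrow> F \<beta> = \<infinity>) \<and> (\<forall>\<beta>. c < \<beta> \<longrightarrow> F \<beta> = 0)"

text \<open>Critical value of F(beta) = lim_n a beta n (the limit being required to exist,
  in the extended reals, at every beta > 0 other than the critical value).\<close>
definition has_critical_value_lim :: "(real \<Rightarrow> nat \<Rightarrow> ereal) \<Rightarrow> real \<Rightarrow> bool" where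
  "has_critical_value_lim a c \<longleftrightarrow>
     (\<forall>\<beta>. 0 < \<beta> \<and> \<beta> < c \<longrightarrow> a \<beta> \<longlonglongrightarrow> \<infinity>) \<and> (\<forall>\<beta>. c < \<beta> \<longrightarrow> a \<beta> \<longlonglongrightarrow> 0)"

end

theory Submission
  imports Defs "HOL-Library.Discrete_Functions" "HOL-Real_Asymp.Real_Asymp"
begin

text \<open>
  Every point of the subshift has, at each level \<open>j\<close>, a unique parsing into words of \<open>C j\<close>: the word 001
  marks the beginnings at level 1, and the first word of \<open>C j\<close> marks the beginnings at level \<open>j + 1\<close>.
  Since each word of \<open>C j\<close> occurs exactly once in every word of \<open>C (j + 1)\<close>, invariance alone gives each
  of them the measure \<open>1 / l (j + 1)\<close>, where \<open>l j\<close> is the length and \<open>N j\<close> the number of the words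
  of \<open>C j\<close>. A window of length \<open>n \<ge> 2 * l j\<close> contains a whole level-\<open>j\<close> word, so its
  information is at least \<open>ln (l (j + 1))\<close>, which is of order \<open>l j powr (1 / 2)\<close> up to arbitrarily small
  changes of the exponent. Conversely, a window inside one level-\<open>(j + 1)\<close> word is determined by its place
  and by the words at the permuted positions it meets; as these are the squares, there are at most about
  \<open>sqrt (n / l j)\<close> of them, and for a typical point none at all as long as \<open>n \<le> l j * N j powr (1 / 4)\<close>.
  On that long range of lengths the information is therefore constant, and lengths of order
  \<open>l j powr (1 / (2 * \<tau>))\<close> realise the critical value \<open>\<tau>\<close>. The exceptional points are removed
  by the Borel-Cantelli lemma.
\<close>

section \<open>Words and squares\<close>

definition block :: "(int \<Rightarrow> 'a) \<Rightarrow> int \<Rightarrow> nat \<Rightarrow> 'a list" where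
  "block x p n = map (\<lambda>k. x (p + int k)) [0..<n]"

lemma length_block [simp]: "length (block x p n) = n"
  by (simp add: block_def)

lemma nth_block [simp]: "k < n \<Longrightarrow> block x p n ! k = x (p + int k)"
  by (simp add: block_def)

lemma take_drop_block: "i + m \<le> n \<Longrightarrow> take m (drop i (block x p n)) = block x (p + int i) m"
  by (rule nth_equalityI) (auto simp: algebra_simps)

lemma block_shift: "block (\<lambda>i. x (i + q)) p n = block x (p + q) n"
  by (simp add: block_def algebra_simps)

lemma take_drop_concat:
  assumes "\<And>w. w \<in> set ws \<Longrightarrow> length w = L" "t < length ws"
  shows "take L (drop (t * L) (concat ws)) = ws ! t"
  using assms
proof (induction ws arbitrary: t)
  case (Cons w ws)
  then show ?case by (cases t) auto
qed simp

lemma length_concat_uniform: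
  assumes "\<And>w. w \<in> set ws \<Longrightarrow> length w = L"
  shows "length (concat ws) = length ws * L"
  using assms by (induction ws) auto

lemma concat_map_concat: "concat (map concat xss) = concat (concat xss)"
  by (induction xss) auto

section \<open>Elementary estimates for factorials and powers\<close>

text \<open>Since \<open>N j < (K j + 1) ^ 2\<close>, this is what makes \<open>N j ^ 2\<close> at
  most \<open>N (j + 1) = fact (K j)\<close>. The induction starts at 7 because 8 ^ 4 = 4096 is
  below 7! = 5040, whereas 7 ^ 4 = 2401 exceeds 6! = 720.\<close>

lemma power4_le_fact: "7 \<le> k \<Longrightarrow> (k + 1) ^ 4 \<le> (fact k :: nat)"
proof (induction k rule: dec_induct)
  case (step k)
  have "2 * 2 \<le> k * k"
    using step.hyps by (intro mult_le_mono) auto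
  then have "(k + 2) ^ 2 \<le> 2 * (k + 1) ^ 2"
    by (simp add: power2_eq_square algebra_simps)
  then have "((k + 2) ^ 2) ^ 2 \<le> (2 * (k + 1) ^ 2) ^ 2"
    by (rule power_mono) simp
  then have "(k + 2) ^ 4 \<le> 4 * (k + 1) ^ 4"
    unfolding power_mult_distrib by (simp flip: power_mult)
  also have "\<dots> \<le> (k + 1) * fact k"
    using step by (intro mult_mono) auto
  finally show ?case by simp
qed (simp add: fact_numeral)

text \<open>The comparison passes through \<open>3 ^ k\<close>, as e is at most 3; from 7 on, where
  3 ^ 7 = 2187 is below 5040, each step multiplies the factorial by more than 3.\<close>

lemma exp_le_fact: "7 \<le> k \<Longrightarrow> exp (real k) \<le> fact k"
proof -
  assume "7 \<le> k"
  then have "3 ^ k \<le> (fact k :: real)"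
  proof (induction k rule: dec_induct)
    case (step k)
    then have "3 * 3 ^ k \<le> (real k + 1) * fact k" by (intro mult_mono) auto
    then show ?case by (simp add: algebra_simps)
  qed (simp add: fact_numeral)
  moreover have "exp (real k) \<le> 3 ^ k"
    using power_mono[OF exp_le, of k] by (simp add: exp_of_nat_mult[symmetric])
  ultimately show ?thesis by linarith
qed

text \<open>The falling factorial has \<open>c\<close> factors, each at most \<open>k\<close>. It
  bounds the share of permutations that is lost when \<open>c\<close> positions are kept
  fixed.\<close>

lemma fact_le_power_mult_fact: "c \<le> k \<Longrightarrow> (fact k :: nat) \<le> k ^ c * fact (k - c)"
proof (induction c)
  case (Suc c)
  have "(fact (k - c) :: nat) = (k - c) * fact (k - Suc c)"
    using Suc.prems by (metis Suc_diff_Suc Suc_le_lessD fact_Suc of_nat_id)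
  then have "(fact (k - c) :: nat) \<le> k * fact (k - Suc c)" by simp
  then have "k ^ c * fact (k - c) \<le> k ^ c * (k * fact (k - Suc c))" by (rule mult_le_mono2)
  also have "\<dots> = k ^ Suc c * fact (k - Suc c)" by simp
  finally show ?case using Suc by linarith
qed simp

lemma square_le_power2: "4 \<le> s \<Longrightarrow> s ^ 2 \<le> (2 ^ s :: nat)"
proof (induction s rule: dec_induct)
  case (step s)
  have "4 * s \<le> s * s"
    using step.hyps by (intro mult_le_mono) auto
  moreover have "(Suc s) ^ 2 = s * s + 2 * s + 1" by (simp add: power2_eq_square)
  ultimately have "(Suc s) ^ 2 \<le> 2 * s ^ 2"
    using step.hyps unfolding power2_eq_square[of s] by linarith
  with step.IH show ?case by simp
qed simp

section \<open>The permuted positions\<close>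

lemma floor_sqrt_eq_nat_floor: "nat \<lfloor>sqrt (real n)\<rfloor> = floor_sqrt n"
proof (rule floor_sqrt_unique[symmetric])
  have "real (nat \<lfloor>sqrt (real n)\<rfloor>) \<le> sqrt n" by simp
  then have "real (nat \<lfloor>sqrt (real n)\<rfloor>) ^ 2 \<le> n"
    by (metis of_nat_0_le_iff real_sqrt_ge_0_iff real_sqrt_pow2 power_mono)
  then have "real (nat \<lfloor>sqrt (real n)\<rfloor> ^ 2) \<le> real n" by simp
  then show "nat \<lfloor>sqrt (real n)\<rfloor> ^ 2 \<le> n" by (simp only: of_nat_le_iff)
  have "sqrt n < real (Suc (nat \<lfloor>sqrt (real n)\<rfloor>))" by (simp) linarith
  then have "sqrt n ^ 2 < real (Suc (nat \<lfloor>sqrt (real n)\<rfloor>)) ^ 2" by (intro power_strict_mono) auto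
  then have "real n < real (Suc (nat \<lfloor>sqrt (real n)\<rfloor>) ^ 2)" by simp
  then show "n < Suc (nat \<lfloor>sqrt (real n)\<rfloor>) ^ 2" using of_nat_less_iff by blast
qed

lemma marker_P_altdef: "marker_P N = insert 2 ((\<lambda>i. i ^ 2) ` {2..floor_sqrt N})"
  by (auto simp: marker_P_def floor_sqrt_eq_nat_floor)

lemma finite_marker_P [simp]: "finite (marker_P N)"
  by (simp add: marker_P_altdef)

lemma two_not_square: "(2::nat) \<noteq> i ^ 2"
proof
  assume *: "(2::nat) = i ^ 2"
  show False
  proof (cases "i \<le> 1")
    case True then show False using * by (cases i) auto
  next
    case False
    then have "2 ^ 2 \<le> i ^ 2" by (intro power_mono) auto
    with * show False by simp
  qed
qed

text \<open>The roots start at 2, and position 2, not being a square, makes up for the missing root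
  1.\<close>

lemma card_marker_P:
  assumes "1 \<le> N"
  shows "card (marker_P N) = floor_sqrt N"
proof -
  have "card ((\<lambda>i. i ^ 2) ` {2..floor_sqrt N}) = floor_sqrt N - 1"
    by (subst card_image) (auto simp: inj_on_def)
  moreover have "2 \<notin> (\<lambda>i. i ^ 2) ` {2..floor_sqrt N}" using two_not_square by auto
  moreover have "floor_sqrt N > 0" using assms by simp
  ultimately show ?thesis by (simp add: marker_P_altdef)
qed

lemma marker_P_subset: "2 \<le> N \<Longrightarrow> marker_P N \<subseteq> {2..N}"
proof -
  assume N: "2 \<le> N"
  have "2 \<le> i ^ 2 \<and> i ^ 2 \<le> N" if "2 \<le> i" "i \<le> floor_sqrt N" for i
  proof
    have "2 * 1 \<le> i * i" using that by (intro mult_le_mono) auto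
    then show "2 \<le> i ^ 2" by (simp add: power2_eq_square)
    show "i ^ 2 \<le> N" using that le_floor_sqrt_iff by blast
  qed
  with N show ?thesis by (auto simp: marker_P_altdef)
qed

text \<open>Squares in an interval of length \<open>d\<close> have roots \<open>i0 + t\<close> with \<open>t ^ 2 \<le> d\<close>,
  where \<open>i0\<close> is the smallest root; the position 2 contributes one more.\<close>

lemma card_marker_P_interval: "card (marker_P N \<inter> {a..a + d}) \<le> floor_sqrt d + 2"
proof -
  define I where "I = {i. a \<le> i ^ 2 \<and> i ^ 2 \<le> a + d}"
  define i0 where "i0 = (LEAST i. i \<in> I)"
  have sub: "I \<subseteq> {i0..i0 + floor_sqrt d}"
  proof
    fix i assume i: "i \<in> I"
    then have i0: "i0 \<in> I" unfolding i0_def by (rule LeastI)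
    have "i0 \<le> i" unfolding i0_def using i by (rule Least_le)
    then obtain t where t: "i = i0 + t" by (auto simp: le_iff_add)
    have "i0 ^ 2 + t ^ 2 \<le> i ^ 2"
      unfolding t by (simp add: power2_eq_square algebra_simps)
    moreover have "a \<le> i0 ^ 2" "i ^ 2 \<le> a + d" using i0 i by (auto simp: I_def)
    ultimately have "t ^ 2 \<le> d" by linarith
    then have "t \<le> floor_sqrt d" by (rule le_floor_sqrtI)
    then show "i \<in> {i0..i0 + floor_sqrt d}" using t by auto
  qed
  have fin: "finite I" using sub finite_subset by blast
  have "card I \<le> floor_sqrt d + 1" using card_mono[OF _ sub] by simp
  have "marker_P N \<inter> {a..a + d} \<subseteq> insert 2 ((\<lambda>i. i ^ 2) ` I)"
    by (auto simp: marker_P_altdef I_def)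
  then have "card (marker_P N \<inter> {a..a + d}) \<le> card (insert 2 ((\<lambda>i. i ^ 2) ` I))"
    using fin by (intro card_mono) auto
  also have "\<dots> \<le> card I + 1"
    using fin card_image_le[OF fin, of "\<lambda>i. i ^ 2"] by (simp add: card_insert_if)
  finally show ?thesis using \<open>card I \<le> floor_sqrt d + 1\<close> by simp
qed

section \<open>The marker words\<close>

text \<open>The bound 36 makes the root \<open>s\<close> of \<open>l1\<close> at least 6, hence
  \<open>N 1 \<ge> 64\<close> and \<open>K 1 \<ge> 8\<close>, so that the factorial estimates apply
  from the first level on.\<close>

locale marker =
  fixes l1 :: nat and C :: "nat \<Rightarrow> nat list list"
  assumes construction: "marker_construction l1 C"
    and large: "36 \<le> l1"
begin

abbreviation "X \<equiv> marker_shift C"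

definition N :: "nat \<Rightarrow> nat" where "N j = length (C j)"
text \<open>Given by the recursion for the lengths and not read off from \<open>C j\<close>; that
  the words of \<open>C j\<close> have this length is part of \<open>basic_aux\<close>.\<close>

definition l :: "nat \<Rightarrow> nat" where "l j = l1 * (\<Prod>i\<in>{1..<j}. N i)"
text \<open>The number of permuted positions, see \<open>card_P\<close>.\<close>

definition K :: "nat \<Rightarrow> nat" where "K j = floor_sqrt (N j)"
text \<open>About the fourth root of \<open>N j\<close>: short windows have lengths up to
  \<open>l j * R j\<close>.\<close>

definition R :: "nat \<Rightarrow> nat" where "R j = floor_sqrt (K j)"
definition P :: "nat \<Rightarrow> nat set" where "P j = marker_P (N j)"
definition word :: "nat \<Rightarrow> (nat \<Rightarrow> nat) \<Rightarrow> nat list" where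
  "word j \<pi> = concat (map (\<lambda>i. C j ! (\<pi> i - 1)) [1..<N j + 1])"

lemma l_1: "l (Suc 0) = l1" by (simp add: l_def)

lemma l_Suc: "1 \<le> j \<Longrightarrow> l (Suc j) = l j * N j"
  by (simp add: l_def)

lemma finite_P [simp]: "finite (P j)" by (simp add: P_def)

lemma N_1: "\<exists>s. l1 = s ^ 2 \<and> 6 \<le> s \<and> N (Suc 0) = 2 ^ s"
proof -
  obtain s where s: "l1 = s ^ 2" "N (Suc 0) = 2 ^ s"
    using conjunct1[OF construction[unfolded marker_construction_def]] unfolding N_def One_nat_def
    by (elim exE conjE)
  have "6 \<le> s"
  proof (rule ccontr)
    assume "\<not> 6 \<le> s"
    then have "s ^ 2 \<le> 5 ^ 2" by (intro power_mono) auto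
    with s(1) large show False by simp
  qed
  with s show ?thesis by (intro exI conjI)
qed

lemma set_C_1:
  "w \<in> set (C (Suc 0)) \<Longrightarrow> length w = l1 \<and> set w \<subseteq> {0, 1} \<and> take 3 w = [0, 0, 1] \<and>
        (\<forall>k. Suc k < length w \<and> w ! k = 0 \<and> w ! Suc k = 0 \<longrightarrow> k = 0)"
  using conjunct1[OF conjunct2[OF conjunct2[OF construction[unfolded marker_construction_def]]]]
  unfolding One_nat_def by (rule bspec)

lemma construction_Suc:
  assumes "1 \<le> j"
  shows "distinct (C (Suc j))" "set (C (Suc j)) = word j ` {\<pi>. \<pi> permutes P j}"
proof -
  have *: "distinct (C (Suc j)) \<and>
        set (C (Suc j)) = {word j \<pi> | \<pi>. \<pi> permutes P j} \<and>
        hd (C (Suc j)) = concat (C j)"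
    using conjunct2[OF conjunct2[OF conjunct2[OF construction[unfolded marker_construction_def]]]] assms
    unfolding word_def P_def N_def by (elim allE impE)
  then show "distinct (C (Suc j))" by (elim conjE)
  from * show "set (C (Suc j)) = word j ` {\<pi>. \<pi> permutes P j}" by auto
qed

lemmas set_C_Suc = construction_Suc(2)

lemma distinct_C: "1 \<le> j \<Longrightarrow> distinct (C j)"
proof (induction j rule: dec_induct)
  case base
  show ?case
    using conjunct1[OF conjunct2[OF construction[unfolded marker_construction_def]]] unfolding One_nat_def .
qed (rule construction_Suc)

lemma permutes_P_range:
  assumes "\<pi> permutes P j" "2 \<le> N j" "1 \<le> i" "i \<le> N j"
  shows "1 \<le> \<pi> i" "\<pi> i \<le> N j"
proof -
  have "P j \<subseteq> {1..N j}" using marker_P_subset[OF assms(2)] by (auto simp: P_def)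
  then have "\<pi> permutes {1..N j}" using assms(1) permutes_subset by blast
  then have "\<pi> i \<in> {1..N j}" using assms(3,4) using permutes_in_image[of \<pi> "{1..N j}" i] by simp
  then show "1 \<le> \<pi> i" "\<pi> i \<le> N j" by auto
qed

text \<open>The common length \<open>L\<close> is a parameter here and in the next lemmas because
  they serve inside the induction that proves it to be \<open>l j\<close>.\<close>

lemma word_blocks:
  assumes "\<pi> permutes P j" "2 \<le> N j" "\<And>w. w \<in> set (C j) \<Longrightarrow> length w = L"
  shows "length (word j \<pi>) = L * N j"
    and "t < N j \<Longrightarrow> take L (drop (t * L) (word j \<pi>)) = C j ! (\<pi> (t + 1) - 1)"
proof -
  let ?ws = "map (\<lambda>i. C j ! (\<pi> i - 1)) [1..<N j + 1]"
  have "\<pi> i - 1 < length (C j)" if "1 \<le> i" "i \<le> N j" for i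
    using permutes_P_range[OF assms(1,2) that] by (simp add: N_def)
  then have "set ?ws \<subseteq> set (C j)" by (auto intro!: nth_mem)
  then have *: "\<And>w. w \<in> set ?ws \<Longrightarrow> length w = L" using assms(3) by blast
  show "length (word j \<pi>) = L * N j"
    unfolding word_def by (subst length_concat_uniform[OF *]) auto
  show "take L (drop (t * L) (word j \<pi>)) = C j ! (\<pi> (t + 1) - 1)" if "t < N j"
    unfolding word_def using that by (subst take_drop_concat[OF *]) (simp_all del: upt_Suc)
qed

lemma word_agree_iff:
  assumes "1 \<le> j" "2 \<le> N j" "\<pi> permutes P j" "\<rho> permutes P j" "1 \<le> i" "i \<le> N j"
  shows "C j ! (\<pi> i - 1) = C j ! (\<rho> i - 1) \<longleftrightarrow> \<pi> i = \<rho> i"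
  using permutes_P_range[OF assms(3,2,5,6)] permutes_P_range[OF assms(4,2,5,6)]
    nth_eq_iff_index_eq[OF distinct_C[OF assms(1)], of "\<pi> i - 1" "\<rho> i - 1"]
  by (auto simp: N_def)

lemma inj_on_word:
  assumes "1 \<le> j" "2 \<le> N j" "\<And>w. w \<in> set (C j) \<Longrightarrow> length w = L"
  shows "inj_on (word j) {\<pi>. \<pi> permutes P j}"
proof (rule inj_onI, clarsimp)
  fix \<pi> \<rho> assume \<pi>: "\<pi> permutes P j" and \<rho>: "\<rho> permutes P j" and eq: "word j \<pi> = word j \<rho>"
  show "\<pi> = \<rho>"
  proof
    fix i show "\<pi> i = \<rho> i"
    proof (cases "i \<in> P j")
      case True
      then have i: "1 \<le> i" "i \<le> N j" using marker_P_subset[OF assms(2)] by (auto simp: P_def)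
      then have "C j ! (\<pi> i - 1) = C j ! (\<rho> i - 1)"
        using word_blocks(2)[where L = L and t = "i - 1", OF \<pi> assms(2,3)] 
          word_blocks(2)[where L = L and t = "i - 1", OF \<rho> assms(2,3)] eq
        by simp
      then show ?thesis using word_agree_iff[OF assms(1,2) \<pi> \<rho> i] by simp
    next
      case False
      then show ?thesis using \<pi> \<rho> by (simp add: permutes_not_in)
    qed
  qed
qed

section \<open>Numbers and lengths of the words\<close>

lemma N_Suc_aux:
  assumes "1 \<le> j" "2 \<le> N j" "\<And>w. w \<in> set (C j) \<Longrightarrow> length w = L"
  shows "N (Suc j) = fact (K j)"
proof -
  have "N (Suc j) = card (set (C (Suc j)))"
    unfolding N_def using distinct_C[of "Suc j"] by (simp add: distinct_card)
  also have "\<dots> = card {\<pi>. \<pi> permutes P j}"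
    unfolding set_C_Suc[OF assms(1)] by (rule card_image[OF inj_on_word[OF assms]])
  also have "\<dots> = fact (K j)"
    using assms(2) by (intro card_permutations) (auto simp: P_def K_def card_marker_P)
  finally show ?thesis .
qed

lemma K_ge_8: "64 \<le> N j \<Longrightarrow> 8 \<le> K j"
  unfolding K_def by (rule le_floor_sqrtI) simp

lemma N_less_K: "N j < (K j + 1) ^ 2"
  using Suc_floor_sqrt_power2_gt by (simp add: K_def)

text \<open>The claims are proved together since counting the words of level \<open>j + 1\<close>
  needs the common length at level \<open>j\<close>. The growth comes from
  \<open>N j ^ 2 \<le> (K j + 1) ^ 4 \<le> fact (K j) = N (j + 1)\<close>, which also carries
  \<open>l j \<le> N j\<close> to the next level.\<close>

lemma basic_aux:
  "1 \<le> j \<Longrightarrow> 64 \<le> N j \<and> 2 ^ (4 * j) \<le> N j \<and> l j \<le> N j \<and> 3 \<le> l j \<and> (\<forall>w\<in>set (C j). length w = l j)"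
proof (induction j rule: dec_induct)
  case base
  obtain s where s: "l1 = s ^ 2" "6 \<le> s" "N (Suc 0) = 2 ^ s" using N_1 by blast
  have "2 ^ 6 \<le> (2 ^ s :: nat)" using s by (intro power_increasing) auto
  then have "64 \<le> (2 ^ s :: nat)" by simp
  then show ?case
    using s square_le_power2[of s] set_C_1 large l_1 by simp
next
  case (step j)
  then have j: "1 \<le> j" by simp
  have N64: "64 \<le> N j" using step by simp
  have N2: "2 \<le> N j" using N64 by simp
  have L: "\<And>w. w \<in> set (C j) \<Longrightarrow> length w = l j" using step by simp
  have NS: "N (Suc j) = fact (K j)" by (rule N_Suc_aux[OF j N2 L])
  have "N j ^ 2 \<le> ((K j + 1) ^ 2) ^ 2"
    using N_less_K[of j] by (intro power_mono) auto
  also have "\<dots> = (K j + 1) ^ 4" by (simp flip: power_mult)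
  also have "\<dots> \<le> N (Suc j)"
    using power4_le_fact[of "K j"] K_ge_8[OF N64] NS by simp
  finally have sq: "N j * N j \<le> N (Suc j)" by (simp add: power2_eq_square)
  have "64 * 64 \<le> N j * N j" "2 ^ (4 * j) * 16 \<le> N j * N j" "l j * N j \<le> N j * N j"
    using step by (intro mult_le_mono; simp)+
  note le = this[THEN order_trans, OF sq]
  from le have "64 \<le> N (Suc j)" "2 ^ (4 * Suc j) \<le> N (Suc j)" "l (Suc j) \<le> N (Suc j)" "3 \<le> l (Suc j)"
    using mult_le_mono[of 3 "l j" 1 "N j"] step N64 unfolding l_Suc[OF j] by (simp_all add: power_add)
  moreover have "\<forall>w\<in>set (C (Suc j)). length w = l (Suc j)"
    using word_blocks(1)[OF _ N2 L] by (auto simp: set_C_Suc[OF j] l_Suc[OF j])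
  ultimately show ?case by blast
qed

lemma N_ge_64: "1 \<le> j \<Longrightarrow> 64 \<le> N j"
  and N_ge_power: "1 \<le> j \<Longrightarrow> 2 ^ (4 * j) \<le> N j"
  and l_le_N: "1 \<le> j \<Longrightarrow> l j \<le> N j"
  and l_ge_3: "1 \<le> j \<Longrightarrow> 3 \<le> l j"
  and length_C: "1 \<le> j \<Longrightarrow> w \<in> set (C j) \<Longrightarrow> length w = l j"
  using basic_aux by blast+

lemma N_ge_2: "1 \<le> j \<Longrightarrow> 2 \<le> N j"
  using N_ge_64[of j] by simp

lemma l_pos: "1 \<le> j \<Longrightarrow> 0 < l j"
  using l_ge_3[of j] by simp

lemma N_Suc: "1 \<le> j \<Longrightarrow> N (Suc j) = fact (K j)"
  using N_Suc_aux length_C N_ge_2 by blast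

lemma card_P: "1 \<le> j \<Longrightarrow> card (P j) = K j"
  using N_ge_2[of j] by (simp add: P_def K_def card_marker_P)

lemma P_subset: "1 \<le> j \<Longrightarrow> P j \<subseteq> {2..N j}"
  using N_ge_2[of j] marker_P_subset by (simp add: P_def)

lemma length_word: "1 \<le> j \<Longrightarrow> \<pi> permutes P j \<Longrightarrow> length (word j \<pi>) = l (Suc j)"
  using length_C[of "Suc j"] set_C_Suc[of j] by auto

lemma word_block:
  "1 \<le> j \<Longrightarrow> \<pi> permutes P j \<Longrightarrow> t < N j \<Longrightarrow>
    take (l j) (drop (t * l j) (word j \<pi>)) = C j ! (\<pi> (t + 1) - 1)"
  using word_blocks(2)[of \<pi> j "l j" t] N_ge_2 length_C by blast

lemma C_nth_mem: "1 \<le> j \<Longrightarrow> \<pi> permutes P j \<Longrightarrow> t < N j \<Longrightarrow> C j ! (\<pi> (t + 1) - 1) \<in> set (C j)"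
  using permutes_P_range[of \<pi> j "t + 1"] N_ge_2[of j] by (auto intro!: nth_mem simp: N_def)

lemma l_less_Suc: "1 \<le> j \<Longrightarrow> l j < l (Suc j)"
  using N_ge_2[of j] l_pos[of j] by (simp add: l_Suc)

lemma l_strict_mono: "1 \<le> i \<Longrightarrow> i < j \<Longrightarrow> l i < l j"
proof (induction j)
  case (Suc j)
  then show ?case using l_less_Suc[of j] by (cases "i = j") auto
qed simp

lemma C_decompose:
  assumes "1 \<le> j" "j \<le> i" "w \<in> set (C i)"
  shows "\<exists>ws. w = concat ws \<and> set ws \<subseteq> set (C j)"
  using assms(2,3)
proof (induction i arbitrary: w rule: dec_induct)
  case base
  then show ?case by (intro exI[of _ "[w]"]) auto
next
  case (step i)
  then have i: "1 \<le> i" using assms(1) by simp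
  obtain \<pi> where \<pi>: "\<pi> permutes P i" "w = word i \<pi>"
    using step.prems set_C_Suc[OF i] by auto
  let ?vs = "map (\<lambda>k. C i ! (\<pi> k - 1)) [1..<N i + 1]"
  have "v \<in> set (C i)" if v: "v \<in> set ?vs" for v
  proof -
    obtain k where "k \<in> set [1..<N i + 1]" "v = C i ! (\<pi> k - 1)"
      using v unfolding set_map image_iff by (elim bexE)
    then show ?thesis using C_nth_mem[OF i \<pi>(1), of "k - 1"] by (auto simp del: upt_Suc)
  qed
  then have "\<forall>v\<in>set ?vs. \<exists>ws. v = concat ws \<and> set ws \<subseteq> set (C j)"
    using step.IH by blast
  then obtain f where f: "\<And>v. v \<in> set ?vs \<Longrightarrow> v = concat (f v) \<and> set (f v) \<subseteq> set (C j)"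
    by metis
  then have "map concat (map f ?vs) = ?vs" by (metis (no_types, lifting) map_idI map_map comp_apply)
  then have "w = concat (concat (map f ?vs))"
    unfolding \<pi>(2) word_def by (metis concat_map_concat)
  moreover have "set (concat (map f ?vs)) \<subseteq> set (C j)"
    unfolding set_concat set_map using f by fastforce
  ultimately show ?case by blast
qed

section \<open>Unique parsing\<close>

text \<open>Mere occurrences of level-\<open>j\<close> words; that for points of \<open>X\<close>
  they form one residue class modulo \<open>l j\<close>, and hence the parsing, is
  \<open>starts_residue\<close>.\<close>

definition starts :: "nat \<Rightarrow> (int \<Rightarrow> nat) \<Rightarrow> int set" where
  "starts j x = {p. block x p (l j) \<in> set (C j)}"

text \<open>Compactness: every finite window is covered by a concatenation of level-\<open>j\<close> words with some
  phase \<open>r\<close>; since there are only finitely many phases, one of them serves all windows.\<close>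

lemma starts_exists:
  assumes x: "x \<in> X" and j: "1 \<le> j"
  shows "\<exists>r. \<forall>m. r + m * int (l j) \<in> starts j x"
proof (rule ccontr)
  let ?L = "int (l j)"
  have L: "0 < ?L" using l_pos[OF j] by simp
  assume "\<not> ?thesis"
  then have "\<forall>r. \<exists>m. r + m * ?L \<notin> starts j x" by blast
  then obtain f where f: "\<And>r. r + f r * ?L \<notin> starts j x" by metis
  \<comment> \<open>A crude bound for the failing places of all phases at once, so that one window
    contains every failing block.\<close>
  define n where "n = (\<Sum>r\<in>{0..<?L}. nat (\<bar>r + f r * ?L\<bar> + ?L))"
  have n: "\<bar>r + f r * ?L\<bar> + ?L \<le> int n" if "r \<in> {0..<?L}" for r
  proof -
    have "nat (\<bar>r + f r * ?L\<bar> + ?L) \<le> n"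
      unfolding n_def using that by (intro member_le_sum) auto
    then show ?thesis by linarith
  qed
  define a where "a = - int n"
  \<comment> \<open>The summand \<open>l j\<close> forces a word containing the window to have
    length at least \<open>l j\<close>, hence level at least \<open>j\<close>.\<close>
  define len where "len = 2 * n + l j"
  obtain i w where i: "1 \<le> i" "w \<in> set (C i)" "sublist (block x a len) w"
    using x unfolding marker_shift_def block_def mem_Collect_eq by blast
  then obtain ps ss where w: "w = ps @ block x a len @ ss" by (auto simp: sublist_def)
  have "l j \<le> l i"
    using w length_C[OF i(1,2)] by (simp add: len_def)
  then have "j \<le> i" using l_strict_mono[OF i(1), of j] by force
  then obtain ws where ws: "w = concat ws" "set ws \<subseteq> set (C j)"
    using C_decompose[OF j _ i(2)] by blast
  have len_ws: "\<And>v. v \<in> set ws \<Longrightarrow> length v = l j" using ws(2) length_C[OF j] by blast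
  define d where "d = length ps"
  \<comment> \<open>The word \<open>w\<close> begins at the place \<open>a - d\<close>, so its
    level-\<open>j\<close> blocks begin at places congruent to \<open>r\<close>. The failing place
    of this phase then carries one of them.\<close>
  define r where "r = (a - int d) mod ?L"
  have r: "r \<in> {0..<?L}" using L by (simp add: r_def)
  define p where "p = r + f r * ?L"
  have pb: "a \<le> p" "p + ?L \<le> int n" using n[OF r] by (auto simp: p_def a_def)
  have "?L dvd p - (a - int d)"
  proof -
    have "?L dvd r - (a - int d)" unfolding r_def by (simp add: mod_eq_dvd_iff[symmetric])
    then have "?L dvd (r - (a - int d)) + f r * ?L" by (intro dvd_add) auto
    then show ?thesis by (simp add: p_def algebra_simps)
  qed
  then obtain q where q: "p - (a - int d) = ?L * q" by blast
  have "0 \<le> ?L * q" using q pb by linarith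
  then have "0 \<le> q" using L by (simp add: zero_le_mult_iff)
  then obtain t where t: "q = int t" using nonneg_int_cases by blast
  define e where "e = nat (p - a)"
  have e: "p = a + int e" "d + e = t * l j"
  proof -
    show "p = a + int e" using pb by (simp add: e_def)
    then have "int (d + e) = int (t * l j)" using q t by (simp add: algebra_simps)
    then show "d + e = t * l j" by (simp only: of_nat_eq_iff)
  qed
  have e_len: "e + l j \<le> len" using pb e(1) unfolding a_def len_def by linarith
  have "length w = length ws * l j" unfolding ws(1) by (rule length_concat_uniform[OF len_ws])
  moreover have "d + e + l j \<le> length w" using e_len w by (simp add: d_def)
  ultimately have "(t + 1) * l j \<le> length ws * l j" using e(2) by simp
  then have "t + 1 \<le> length ws" using l_pos[OF j] by (simp only: mult_le_cancel2)
  then have t_less: "t < length ws" by simp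
  have "block x p (l j) = take (l j) (drop e (block x a len))"
    unfolding e(1) by (rule take_drop_block[OF e_len, symmetric])
  also have "\<dots> = take (l j) (drop (d + e) w)"
    using e_len by (simp add: w d_def)
  also have "\<dots> = ws ! t"
    unfolding e(2) ws(1) by (rule take_drop_concat[OF len_ws t_less])
  finally have "block x p (l j) \<in> set (C j)" using ws(2) t_less nth_mem by fastforce
  with f[of r] show False by (simp add: starts_def p_def)
qed

lemma starts_word:
  assumes "1 \<le> j" "p \<in> starts (Suc j) x"
  obtains \<pi> where "\<pi> permutes P j" "block x p (l (Suc j)) = word j \<pi>"
    "\<And>t. t < N j \<Longrightarrow> block x (p + int (t * l j)) (l j) = C j ! (\<pi> (t + 1) - 1)"
proof -
  obtain \<pi> where \<pi>: "\<pi> permutes P j" "block x p (l (Suc j)) = word j \<pi>"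
    using assms by (auto simp: starts_def set_C_Suc)
  have "block x (p + int (t * l j)) (l j) = C j ! (\<pi> (t + 1) - 1)" if "t < N j" for t
  proof -
    have "(t + 1) * l j \<le> N j * l j" using that by (intro mult_le_mono) auto
    then have "t * l j + l j \<le> l (Suc j)" by (simp add: l_Suc[OF assms(1)] algebra_simps)
    from take_drop_block[OF this, of x p]
    show ?thesis using word_block[OF assms(1) \<pi>(1) that] \<pi>(2) by simp
  qed
  then show ?thesis using \<pi> that by blast
qed

lemma starts_Suc_block:
  assumes "1 \<le> j" "p \<in> starts (Suc j) x" "t < N j"
  shows "p + int (t * l j) \<in> starts j x"
proof -
  obtain \<pi> where \<pi>: "\<pi> permutes P j"
    and b: "\<And>t. t < N j \<Longrightarrow> block x (p + int (t * l j)) (l j) = C j ! (\<pi> (t + 1) - 1)"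
    using starts_word[OF assms(1,2)] by blast
  show ?thesis
    unfolding starts_def mem_Collect_eq b[OF assms(3)] by (rule C_nth_mem[OF assms(1) \<pi> assms(3)])
qed

text \<open>Only the first position of a level-\<open>(j + 1)\<close> word carries the first word of \<open>C j\<close>, so this word
  marks the beginnings of the level-\<open>(j + 1)\<close> words.\<close>

lemma first_block:
  assumes j: "1 \<le> j" and p: "p \<in> starts (Suc j) x" and t: "t < N j"
  shows "block x (p + int (t * l j)) (l j) = C j ! 0 \<longleftrightarrow> t = 0"
proof -
  obtain \<pi> where \<pi>: "\<pi> permutes P j"
    and b: "\<And>t. t < N j \<Longrightarrow> block x (p + int (t * l j)) (l j) = C j ! (\<pi> (t + 1) - 1)"
    using starts_word[OF j p] by blast
  \<comment> \<open>Here it matters that 1 is not a permuted position.\<close>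
  have one: "\<pi> 1 = 1" using \<pi> P_subset[OF j] by (intro permutes_not_in[OF \<pi>]) auto
  have "1 \<le> \<pi> (t + 1)" "\<pi> (t + 1) \<le> N j"
    using permutes_P_range[OF \<pi> N_ge_2[OF j], of "t + 1"] t by auto
  then have "C j ! (\<pi> (t + 1) - 1) = C j ! 0 \<longleftrightarrow> \<pi> (t + 1) - 1 = 0"
    using t by (intro nth_eq_iff_index_eq[OF distinct_C[OF j]]) (auto simp: N_def)
  also have "\<dots> \<longleftrightarrow> \<pi> (t + 1) = \<pi> 1" using \<open>1 \<le> \<pi> (t + 1)\<close> one by auto
  also have "\<dots> \<longleftrightarrow> t = 0" using permutes_inj[OF \<pi>] by (auto dest: injD)
  finally show ?thesis using b[OF t] by simp
qed

text \<open>A word at \<open>p\<close> puts 00 at \<open>p\<close> and \<open>p + 1\<close>. If both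
  places lie in one block of the grid given by \<open>starts_exists\<close>, they are its prefix.
  Otherwise \<open>p\<close> is the last place of a block, and \<open>p + 2\<close> carries the
  second letter of the next block, which is 0, while 001 at \<open>p\<close> demands 1.\<close>

lemma starts_residue_1:
  assumes x: "x \<in> X"
  shows "\<exists>r. \<forall>p. p \<in> starts (Suc 0) x \<longleftrightarrow> int (l (Suc 0)) dvd p - r"
proof -
  let ?L = "int (l (Suc 0))"
  obtain r where r: "\<And>m. r + m * ?L \<in> starts (Suc 0) x"
    using starts_exists[OF x, of "Suc 0"] by auto
  have L3: "3 \<le> ?L" using l_ge_3[of "Suc 0"] by simp
  have pre: "x q = 0" "x (q + 1) = 0" "x (q + 2) = 1"
    and only: "\<And>k. \<lbrakk>Suc k < l (Suc 0); x (q + int k) = 0; x (q + int k + 1) = 0\<rbrakk> \<Longrightarrow> k = 0"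
    if q: "q \<in> starts (Suc 0) x" for q
  proof -
    let ?w = "block x q (l (Suc 0))"
    have w: "take 3 ?w = [0, 0, 1]"
      and *: "\<And>k. Suc k < length ?w \<Longrightarrow> ?w ! k = 0 \<Longrightarrow> ?w ! Suc k = 0 \<Longrightarrow> k = 0"
      using set_C_1[OF q[unfolded starts_def mem_Collect_eq]] by blast+
    have "take 3 ?w ! i = x (q + int i)" if "i < 3" for i
      using that L3 by simp
    from this[of 0] this[of 1] this[of 2] show "x q = 0" "x (q + 1) = 0" "x (q + 2) = 1"
      unfolding w by auto
    show "k = 0" if "Suc k < l (Suc 0)" "x (q + int k) = 0" "x (q + int k + 1) = 0" for k
      by (rule *) (use that in \<open>simp_all add: ac_simps\<close>)
  qed
  have "?L dvd p - r" if p: "p \<in> starts (Suc 0) x" for p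
  proof -
    define m where "m = (p - r) div ?L"
    define k where "k = nat ((p - r) mod ?L)"
    have k: "int k = (p - r) mod ?L" "int k < ?L" using L3 by (auto simp: k_def)
    have pk: "p = (r + m * ?L) + int k"
      using div_mult_mod_eq[of "p - r" ?L] unfolding k(1) m_def by linarith
    show ?thesis
    proof (cases "Suc k < l (Suc 0)")
      case True
      have "k = 0"
        by (rule only[OF r[of m] True]) (use pre(1,2)[OF p] in \<open>simp_all only: pk\<close>)
      then show ?thesis using pk by simp
    next
      case False
      then have "int k + 1 = ?L" using k(2) by linarith
      then have "r + (m + 1) * ?L + 1 = p + 2" unfolding pk distrib_right by linarith
      with pre(2)[OF r[of "m + 1"]] pre(3)[OF p] show ?thesis by (simp only: zero_neq_one)
    qed
  qed
  moreover have "p \<in> starts (Suc 0) x" if "?L dvd p - r" for p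
  proof -
    obtain m where "p - r = ?L * m" using \<open>?L dvd p - r\<close> by blast
    then have "p = r + m * ?L" by (simp add: algebra_simps)
    then show ?thesis using r[of m] by simp
  qed
  ultimately show ?thesis by blast
qed

text \<open>Both \<open>p\<close> and the level-\<open>(j + 1)\<close> grid lie on the
  level-\<open>j\<close> grid, so \<open>p\<close> is the beginning of some block number
  \<open>t\<close> of a grid word. That block is the first word of \<open>C j\<close>, and by
  \<open>first_block\<close> this happens only for \<open>t = 0\<close>.\<close>

lemma starts_residue_Suc:
  assumes x: "x \<in> X" and j: "1 \<le> j" and r0: "\<And>p. p \<in> starts j x \<longleftrightarrow> int (l j) dvd p - r0"
  shows "\<exists>r. \<forall>p. p \<in> starts (Suc j) x \<longleftrightarrow> int (l (Suc j)) dvd p - r"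
proof -
  let ?L = "int (l (Suc j))"
  obtain r where r: "\<And>m. r + m * ?L \<in> starts (Suc j) x"
    using starts_exists[OF x, of "Suc j"] by auto
  have sub: "p \<in> starts j x" if "p \<in> starts (Suc j) x" for p
    using starts_Suc_block[OF j that, of 0] N_ge_2[OF j] by simp
  have Lpos: "0 < ?L" using l_pos[of "Suc j"] by simp
  have "?L dvd p - r" if p: "p \<in> starts (Suc j) x" for p
  proof -
    have "int (l j) dvd (p - r0) - (r - r0)"
      by (rule dvd_diff) (use r0[of p] r0[of r] sub[OF p] sub[OF r[of 0]] in simp_all)
    then have dv: "int (l j) dvd p - r" by simp
    define m where "m = (p - r) div ?L"
    define k where "k = (p - r) mod ?L"
    have k: "0 \<le> k" "k < ?L" using Lpos by (auto simp: k_def)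
    have pk: "p = (r + m * ?L) + k"
      using div_mult_mod_eq[of "p - r" ?L] unfolding k_def m_def by linarith
    have "int (l j) dvd ?L" by (simp add: l_Suc[OF j])
    then have "int (l j) dvd k" using dv by (simp add: k_def dvd_mod_iff)
    then obtain u where u: "k = int (l j) * u" by blast
    have "0 \<le> u" using k(1) u l_pos[OF j] by (simp add: zero_le_mult_iff)
    then obtain t where t: "u = int t" using nonneg_int_cases by blast
    have kt: "k = int (t * l j)" using u t by simp
    then have "t * l j < l j * N j" using k(2) unfolding l_Suc[OF j] by linarith
    then have tN: "t < N j" by simp
    have "block x p (l j) = C j ! 0"
      using first_block[OF j p, of 0] N_ge_2[OF j] by simp
    then have "t = 0" using first_block[OF j r[of m] tN] pk kt by simp
    then show ?thesis using pk kt by simp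
  qed
  moreover have "p \<in> starts (Suc j) x" if "?L dvd p - r" for p
  proof -
    obtain m where "p - r = ?L * m" using \<open>?L dvd p - r\<close> by blast
    then have "p = r + m * ?L" by (simp add: algebra_simps)
    then show ?thesis using r[of m] by simp
  qed
  ultimately show ?thesis by blast
qed

lemma starts_residue:
  assumes x: "x \<in> X" and "1 \<le> j"
  shows "\<exists>r. \<forall>p. p \<in> starts j x \<longleftrightarrow> int (l j) dvd p - r"
  using assms(2)
proof (induction j rule: dec_induct)
  case base
  then show ?case using starts_residue_1[OF x] by simp
next
  case (step j)
  then show ?case using starts_residue_Suc[OF x] by blast
qed

text \<open>Here \<open>k\<close> is the place of coordinate 0 in its level-\<open>j\<close> word.
  Existence makes the corresponding events cover \<open>X\<close>, and uniqueness makes them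
  disjoint.\<close>

lemma starts_ex1:
  assumes "x \<in> X" "1 \<le> j"
  shows "\<exists>!k. k < l j \<and> - int k \<in> starts j x"
proof -
  obtain r where r: "\<And>p. p \<in> starts j x \<longleftrightarrow> int (l j) dvd p - r"
    using starts_residue[OF assms] by blast
  have L: "0 < int (l j)" using l_pos[OF assms(2)] by simp
  define k where "k = nat ((- r) mod int (l j))"
  have k: "int k = (- r) mod int (l j)" using L by (simp add: k_def)
  have "k < l j" using L k by (metis of_nat_less_iff pos_mod_bound)
  moreover have "int (l j) dvd - r - int k" unfolding k by (simp add: mod_eq_dvd_iff[symmetric])
  then have "- int k \<in> starts j x" by (simp add: r minus_diff_commute)
  moreover have "k' = k" if "k' < l j" "- int k' \<in> starts j x" for k'
  proof -
    have "- r - int k' = - int k' - r" by simp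
    then have "int (l j) dvd - r - int k'" using that(2) r by metis
    then have "(- r) mod int (l j) = int k' mod int (l j)" by (simp add: mod_eq_dvd_iff)
    then show ?thesis using k that(1) by simp
  qed
  ultimately show ?thesis by blast
qed

lemma starts_Suc_ex1:
  assumes x: "x \<in> X" and j: "1 \<le> j" and 0: "0 \<in> starts j x"
  shows "\<exists>!t. t < N j \<and> - int (t * l j) \<in> starts (Suc j) x"
proof -
  obtain k where k: "k < l (Suc j)" "- int k \<in> starts (Suc j) x"
    and uniq: "\<And>k'. k' < l (Suc j) \<Longrightarrow> - int k' \<in> starts (Suc j) x \<Longrightarrow> k' = k"
    using starts_ex1[OF x, of "Suc j"] by auto
  obtain r where r: "\<And>p. p \<in> starts j x \<longleftrightarrow> int (l j) dvd p - r"
    using starts_residue[OF x j] by blast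
  have "- int k \<in> starts j x"
    using starts_Suc_block[OF j k(2), of 0] N_ge_2[OF j] by simp
  then have "int (l j) dvd - int k - r" "int (l j) dvd 0 - r" using 0 r by blast+
  then have "int (l j) dvd (0 - r) - (- int k - r)" by (rule dvd_diff[rotated])
  then have "l j dvd k" by simp
  then obtain t where t: "k = t * l j" by (metis dvd_div_mult_self)
  have "t < N j" using k(1) unfolding t l_Suc[OF j] by (simp add: mult.commute)
  moreover have "t' = t" if "t' < N j" "- int (t' * l j) \<in> starts (Suc j) x" for t'
  proof -
    have "t' * l j < N j * l j" using that(1) l_pos[OF j] by simp
    then have "t' * l j = k" using uniq that(2) by (simp add: l_Suc[OF j] mult.commute)
    then show ?thesis using t l_pos[OF j] by simp
  qed
  ultimately show ?thesis using k(2) t by blast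
qed

text \<open>The permuted positions \<open>i\<close> whose block, occupying the places from \<open>(i - 1) * l j\<close> up to
  \<open>i * l j\<close>, meets the window of length \<open>n\<close> beginning at the place \<open>k\<close> of a level-\<open>(j + 1)\<close> word.\<close>

definition hits :: "nat \<Rightarrow> nat \<Rightarrow> nat \<Rightarrow> nat set" where
  "hits j k n = {i \<in> P j. k < i * l j \<and> (i - 1) * l j < k + n}"

lemma card_hits_le_K: "1 \<le> j \<Longrightarrow> card (hits j k n) \<le> K j"
  unfolding card_P[symmetric] by (rule card_mono) (auto simp: hits_def)

text \<open>The blocks met by the window are consecutive, at most \<open>n div l j + 2\<close> of
  them, and few squares lie in an interval of that length.\<close>

lemma card_hits_le:
  assumes j: "1 \<le> j"
  shows "card (hits j k n) \<le> floor_sqrt (n div l j + 1) + 2"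
proof -
  let ?a = "k div l j + 1" and ?d = "n div l j + 1"
  have "hits j k n \<subseteq> marker_P (N j) \<inter> {?a..?a + ?d}"
  proof
    fix i assume i: "i \<in> hits j k n"
    then have lo: "k < i * l j" and hi: "(i - 1) * l j < k + n" and P: "i \<in> marker_P (N j)"
      by (auto simp: hits_def P_def)
    have "k div l j < i" using lo by (simp add: less_mult_imp_div_less)
    moreover have "i - 1 \<le> (k + n) div l j"
      using hi l_pos[OF j] by (simp add: less_eq_div_iff_mult_less_eq)
    \<comment> \<open>The remainders of \<open>k\<close> and \<open>n\<close> produce a carry of at
      most 1.\<close>
    moreover have "(k + n) div l j \<le> k div l j + n div l j + 1"
    proof -
      have "(k mod l j + n mod l j) div l j < 2"
        by (rule less_mult_imp_div_less)
           (use mod_less_divisor[OF l_pos[OF j], of k] mod_less_divisor[OF l_pos[OF j], of n] in linarith)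
      then show ?thesis using div_add1_eq[of k n "l j"] by linarith
    qed
    ultimately show "i \<in> marker_P (N j) \<inter> {?a..?a + ?d}" using P by auto
  qed
  then have "card (hits j k n) \<le> card (marker_P (N j) \<inter> {?a..?a + ?d})" by (intro card_mono) auto
  also have "\<dots> \<le> floor_sqrt ?d + 2" by (rule card_marker_P_interval)
  finally show ?thesis .
qed

lemma word_nth:
  assumes j: "1 \<le> j" and \<pi>: "\<pi> permutes P j" and m: "m < l (Suc j)"
  shows "m div l j < N j" "word j \<pi> ! m = (C j ! (\<pi> (m div l j + 1) - 1)) ! (m mod l j)"
proof -
  let ?t = "m div l j"
  show t: "?t < N j" using m by (simp add: l_Suc[OF j] less_mult_imp_div_less mult.commute)
  have r: "m mod l j < l j" using l_pos[OF j] by simp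
  have m_eq: "m = ?t * l j + m mod l j" by simp
  have "(C j ! (\<pi> (?t + 1) - 1)) ! (m mod l j) = take (l j) (drop (?t * l j) (word j \<pi>)) ! (m mod l j)"
    unfolding word_block[OF j \<pi> t] ..
  also have "\<dots> = drop (?t * l j) (word j \<pi>) ! (m mod l j)" using r by simp
  also have "\<dots> = word j \<pi> ! (?t * l j + m mod l j)"
    by (rule nth_drop) (use m length_word[OF j \<pi>] m_eq in linarith)
  finally show "word j \<pi> ! m = (C j ! (\<pi> (?t + 1) - 1)) ! (m mod l j)" using m_eq by simp
qed

text \<open>The letter at \<open>m\<close> lies in block \<open>m div l j + 1\<close>, which meets
  the window. That position is either not in \<open>P j\<close> or a hit, and in both cases
  \<open>\<rho>\<close> fixes it.\<close>

lemma word_agree_off_hits: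
  assumes j: "1 \<le> j" and \<pi>: "\<pi> permutes P j" and \<rho>: "\<rho> permutes P j - hits j k n"
    and m: "k \<le> m" "m < k + n" "m < l (Suc j)"
  shows "word j (\<pi> \<circ> \<rho>) ! m = word j \<pi> ! m"
proof -
  let ?t = "m div l j"
  have "\<rho> permutes P j" using \<rho> permutes_subset by blast
  then have \<pi>\<rho>: "(\<pi> \<circ> \<rho>) permutes P j" using \<pi> by (rule permutes_compose)
  have m_eq: "m = ?t * l j + m mod l j" and r: "m mod l j < l j" using l_pos[OF j] by simp_all
  have "?t + 1 \<notin> P j - hits j k n"
  proof -
    have "(?t + 1) * l j = ?t * l j + l j" by simp
    then have "k < (?t + 1) * l j" "(?t + 1 - 1) * l j < k + n" using m_eq r m unfolding add_diff_cancel_right' by linarith+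
    then show ?thesis unfolding hits_def by blast
  qed
  then have "\<rho> (?t + 1) = ?t + 1" using \<rho> by (simp add: permutes_not_in)
  then show ?thesis
    unfolding word_nth(2)[OF j \<pi>\<rho> m(3)] word_nth(2)[OF j \<pi> m(3)] by simp
qed

section \<open>Cylinders and translates\<close>

lemma cyl_altdef: "cyl X n x = {y \<in> X. block y 0 n = block x 0 n}"
  by (auto simp: cyl_def list_eq_iff_nth_eq)

lemma starts_shift: "p \<in> starts j (\<lambda>i. y (i + q)) \<longleftrightarrow> p + q \<in> starts j y"
  by (simp add: starts_def block_shift)

lemma X_shift: "(\<lambda>i. y (i + q)) \<in> X \<longleftrightarrow> y \<in> X"
proof -
  have *: "(\<lambda>i. y (i + q)) \<in> X" if "y \<in> X" for y q
    using that unfolding marker_shift_def mem_Collect_eq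
  proof (intro allI)
    fix a n
    assume "\<forall>a n. \<exists>j\<ge>1. \<exists>w\<in>set (C j). sublist (map (\<lambda>k. y (a + int k)) [0..<n]) w"
    from this[rule_format, of "a + q" n]
    show "\<exists>j\<ge>1. \<exists>w\<in>set (C j). sublist (map (\<lambda>k. y (a + int k + q)) [0..<n]) w"
      by (simp only: ac_simps)
  qed
  show ?thesis using *[of y q] *[of "\<lambda>i. y (i + q)" "- q"] by auto
qed

section \<open>Growth of the construction\<close>

lemma K_sq_le: "K j * K j \<le> N j"
  using floor_sqrt_power2_le[of "N j"] by (simp add: K_def power2_eq_square)

lemma R_sq_le: "R j * R j \<le> K j"
  using floor_sqrt_power2_le[of "K j"] by (simp add: R_def power2_eq_square)

lemma R_ge: "1 \<le> j \<Longrightarrow> 2 ^ j \<le> R j"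
  unfolding R_def K_def
  by (intro le_floor_sqrtI) (use N_ge_power[of j] in \<open>simp add: mult.commute flip: power_mult\<close>)

lemma R_pos: "1 \<le> j \<Longrightarrow> 1 \<le> R j"
  using R_ge[of j] order_trans one_le_power[of "2::nat" j] by force

lemma K_ge: "1 \<le> j \<Longrightarrow> 2 ^ j \<le> K j"
proof -
  assume j: "1 \<le> j"
  have "R j * 1 \<le> R j * R j" using R_pos[OF j] by (intro mult_le_mono) auto
  then show ?thesis using R_ge[OF j] R_sq_le[of j] by linarith
qed

lemma N_less_R: "N j < (R j + 1) ^ 4"
proof -
  have "K j < (R j + 1) ^ 2" using Suc_floor_sqrt_power2_gt[of "K j"] by (simp add: R_def)
  then have "(K j + 1) ^ 2 \<le> ((R j + 1) ^ 2) ^ 2" by (intro power_mono) auto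
  also have "\<dots> = (R j + 1) ^ 4" by (simp flip: power_mult)
  finally show ?thesis using N_less_K[of j] by linarith
qed

text \<open>The windows \<open>n \<le> reach (j + 1)\<close> typically lie in a single level-\<open>(j + 1)\<close> word.\<close>

definition reach :: "nat \<Rightarrow> nat" where "reach j = l j div 2 ^ j"

lemma window_le_reach: "1 \<le> j \<Longrightarrow> l j * R j \<le> reach (Suc j)"
proof -
  assume j: "1 \<le> j"
  have "R j * 2 ^ Suc j \<le> R j * (2 * R j)" using R_ge[OF j] by (intro mult_le_mono) auto
  also have "\<dots> \<le> 2 * K j" using R_sq_le[of j] by linarith
  also have "\<dots> \<le> K j * K j" using K_ge_8[OF N_ge_64[OF j]] by (intro mult_le_mono) auto
  also have "\<dots> \<le> N j" by (rule K_sq_le)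
  finally have "l j * (R j * 2 ^ Suc j) \<le> l j * N j" by (rule mult_le_mono2)
  then have "l j * R j * 2 ^ Suc j \<le> l (Suc j)" by (simp only: l_Suc[OF j] mult.assoc)
  then show ?thesis unfolding reach_def by (subst less_eq_div_iff_mult_less_eq) auto
qed

text \<open>Here \<open>k\<close> is the place of coordinate 0 in its level-\<open>(j + 1)\<close>
  word. Outside \<open>bad j\<close> the long windows stay in that word and the short ones see no
  permuted position.\<close>

definition bad :: "nat \<Rightarrow> nat set" where
  "bad j = {k. k < l (Suc j) \<and> (l (Suc j) < k + reach (Suc j) \<or> hits j k (l j * R j) \<noteq> {})}"

lemma card_bad:
  assumes j: "1 \<le> j"
  shows "card (bad j) \<le> reach (Suc j) + K j * (l j + l j * R j)"
proof -
  let ?L = "l (Suc j)" and ?n = "l j * R j"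
  \<comment> \<open>The places from which the window can meet block \<open>p\<close>; truncated
    subtraction only shortens the interval near 0.\<close>
  define I where "I p = {(p - 1) * l j - ?n..<p * l j}" for p
  have "bad j \<subseteq> {?L - reach (Suc j)..<?L} \<union> (\<Union>p\<in>P j. I p)"
  proof
    fix k assume k: "k \<in> bad j"
    show "k \<in> {?L - reach (Suc j)..<?L} \<union> (\<Union>p\<in>P j. I p)"
    proof (cases "?L < k + reach (Suc j)")
      case True
      then show ?thesis using k by (auto simp: bad_def)
    next
      case False
      then obtain p where "p \<in> hits j k ?n" using k by (auto simp: bad_def)
      then have "p \<in> P j" "k \<in> I p" by (auto simp: hits_def I_def)
      then show ?thesis by blast
    qed
  qed
  then have "card (bad j) \<le> card ({?L - reach (Suc j)..<?L} \<union> (\<Union>p\<in>P j. I p))"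
    by (rule card_mono[rotated]) (auto simp: I_def)
  also have "\<dots> \<le> card {?L - reach (Suc j)..<?L} + card (\<Union>p\<in>P j. I p)" by (rule card_Un_le)
  finally have *: "card (bad j) \<le> reach (Suc j) + card (\<Union>p\<in>P j. I p)" by simp
  have "card (\<Union>p\<in>P j. I p) \<le> (\<Sum>p\<in>P j. card (I p))" by (rule card_UN_le) simp
  also have "\<dots> \<le> (\<Sum>p\<in>P j. l j + ?n)"
  proof (rule sum_mono)
    fix p assume "p \<in> P j"
    then have "1 \<le> p" using P_subset[OF j] by auto
    then obtain q where "p = Suc q" by (cases p) auto
    then show "card (I p) \<le> l j + ?n" by (simp add: I_def)
  qed
  finally show ?thesis using * by (simp add: card_P[OF j])
qed

text \<open>The end of the word contributes \<open>1 / 2 ^ (j + 1)\<close>. The permuted positions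
  contribute at most \<open>2 * K * R / N \<le> 2 * R / K \<le> 2 / R \<le> 2 / 2 ^ j\<close>, which
  is why short windows are only \<open>R j\<close> blocks long.\<close>

lemma card_bad_ratio:
  assumes j: "1 \<le> j"
  shows "card (bad j) / l (Suc j) \<le> 3 * (1 / 2) ^ j"
proof -
  have pos: "0 < real (l j)" "0 < real (l (Suc j))" "0 < real (N j)" "0 < real (K j)" "1 \<le> real (R j)"
    using l_pos[OF j] l_pos[of "Suc j"] N_ge_2[OF j] K_ge_8[OF N_ge_64[OF j]] R_pos[OF j] by simp_all
  have reach: "real (reach (Suc j)) \<le> l (Suc j) / 2 ^ Suc j"
  proof -
    have "real (reach (Suc j) * 2 ^ Suc j) \<le> l (Suc j)"
      unfolding reach_def of_nat_le_iff by (rule div_times_less_eq_dividend)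
    then show ?thesis by (simp add: field_simps)
  qed
  have KN: "real (K j) * K j \<le> N j" using K_sq_le[of j] by (simp flip: of_nat_mult)
  have RK: "real (R j) * R j \<le> K j" using R_sq_le[of j] by (simp flip: of_nat_mult)
  have "real (card (bad j)) \<le> real (reach (Suc j) + K j * (l j + l j * R j))"
    using card_bad[OF j] by (simp only: of_nat_le_iff)
  also have "\<dots> = real (reach (Suc j)) + real (l j) * (real (K j) * (1 + real (R j)))"
    by (simp add: algebra_simps)
  also have "\<dots> \<le> l (Suc j) / 2 ^ Suc j + real (l j) * (real (K j) * (2 * real (R j)))"
    using reach pos by (intro add_mono mult_left_mono) auto
  finally have "card (bad j) / l (Suc j) \<le> (l (Suc j) / 2 ^ Suc j + l j * (K j * (2 * R j))) / l (Suc j)"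
    by (intro divide_right_mono) auto
  also have "\<dots> = 1 / 2 ^ Suc j + K j * (2 * R j) / N j"
    using pos by (simp add: add_divide_distrib l_Suc[OF j])
  also have "K j * (2 * R j) / N j \<le> K j * (2 * R j) / (real (K j) * K j)"
    using KN pos by (intro divide_left_mono) auto
  also have "\<dots> = 2 * R j / K j" using pos by simp
  also have "\<dots> \<le> 2 * R j / (real (R j) * R j)"
    using RK pos by (intro divide_left_mono) auto
  also have "\<dots> = 2 / R j" using pos by simp
  also have "\<dots> \<le> 2 / 2 ^ j"
  proof -
    have "real (2 ^ j) \<le> R j" using R_ge[OF j] by (simp only: of_nat_le_iff)
    then show ?thesis by (intro divide_left_mono) (use pos in auto)
  qed
  also have "1 / 2 ^ Suc j + 2 / 2 ^ j \<le> 3 * (1 / 2 :: real) ^ j"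
    by (simp add: power_one_over divide_simps)
  finally show ?thesis by simp
qed

section \<open>Asymptotic relations between consecutive levels\<close>

lemma filterlim_K: "filterlim (\<lambda>j. real (K j)) at_top sequentially"
proof (rule filterlim_at_top_mono)
  show "filterlim real at_top sequentially" by (rule filterlim_real_sequentially)
  show "\<forall>\<^sub>F j in sequentially. real j \<le> real (K j)"
    using eventually_ge_at_top[of 1]
  proof eventually_elim
    case (elim j)
    have "j < 2 ^ j" by (rule less_exp)
    then show ?case using K_ge[OF elim] by linarith
  qed
qed

text \<open>Growth estimates are proved for a real variable and then evaluated at
  \<open>K j\<close>, in terms of which both \<open>N j\<close> and \<open>N (j + 1)\<close> are
  controlled.\<close>

lemma eventually_K:
  assumes "eventually Q at_top"
  shows "\<forall>\<^sub>F j in sequentially. 1 \<le> j \<and> 8 \<le> K j \<and> Q (real (K j))"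
proof -
  have "\<forall>\<^sub>F j in sequentially. Q (real (K j))"
    using eventually_compose_filterlim[OF assms filterlim_K] .
  then show ?thesis using eventually_ge_at_top[of 1]
    by eventually_elim (use K_ge_8 N_ge_64 in blast)
qed

lemma filterlim_l: "filterlim (\<lambda>j. real (l j)) at_top sequentially"
proof (rule filterlim_at_top_mono)
  show "filterlim (\<lambda>j. real (j - 1)) at_top sequentially" by real_asymp
  show "\<forall>\<^sub>F j in sequentially. real (j - 1) \<le> real (l j)"
    using eventually_ge_at_top[of 1]
  proof eventually_elim
    case (elim j)
    then have "j - 1 \<le> l j"
    proof (induction j rule: dec_induct)
      case (step j)
      then show ?case using l_less_Suc[of j] by simp
    qed simp
    then show ?case by simp
  qed
qed

lemma exp_K_le: "1 \<le> j \<Longrightarrow> exp (real (K j)) \<le> N (Suc j)"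
  using exp_le_fact[of "K j"] K_ge_8[OF N_ge_64[of j]] by (simp add: N_Suc)

text \<open>\<open>l (j + 1) \<le> N j ^ 2\<close> is polynomial in \<open>K j\<close>, whereas
  \<open>R (j + 1)\<close>, about the fourth root of \<open>fact (K j)\<close>, is at least
  \<open>exp (K j / 4) - 1\<close>.\<close>

lemma l_powr_le_R:
  assumes A: "0 \<le> A"
  shows "\<forall>\<^sub>F j in sequentially. real (l j) powr A \<le> R j"
proof -
  have "\<forall>\<^sub>F y in at_top. ((y + 1) ^ 4) powr A \<le> exp (y / 4) - (1::real)"
    using A by real_asymp
  from eventually_K[OF this] have "\<forall>\<^sub>F j in sequentially. real (l (Suc j)) powr A \<le> R (Suc j)"
  proof eventually_elim
    case (elim j)
    then have j: "1 \<le> j" by simp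
    have "l (Suc j) \<le> N j * N j" using l_le_N[OF j] by (simp add: l_Suc[OF j])
    also have "\<dots> \<le> (K j + 1) ^ 2 * (K j + 1) ^ 2" using N_less_K[of j] by (intro mult_le_mono) auto
    finally have "l (Suc j) \<le> (K j + 1) ^ 4" by (simp flip: power_add)
    then have "real (l (Suc j)) \<le> real ((K j + 1) ^ 4)" by (simp only: of_nat_le_iff)
    then have "real (l (Suc j)) \<le> (real (K j) + 1) ^ 4" by (simp add: add.commute)
    then have "real (l (Suc j)) powr A \<le> ((real (K j) + 1) ^ 4) powr A"
      using A by (intro powr_mono2) auto
    also have "\<dots> \<le> exp (real (K j) / 4) - 1" using elim by simp
    also have "exp (real (K j) / 4) \<le> real (R (Suc j)) + 1"
    proof (rule power_le_imp_le_base[of _ 3])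
      have "exp (real (K j) / 4) ^ Suc 3 = exp (real (K j))"
        by (simp flip: exp_of_nat_mult)
      also have "\<dots> \<le> N (Suc j)" by (rule exp_K_le[OF j])
      also have "\<dots> \<le> real ((R (Suc j) + 1) ^ 4)" using N_less_R[of "Suc j"] by (simp only: of_nat_le_iff less_imp_le)
      finally show "exp (real (K j) / 4) ^ Suc 3 \<le> (real (R (Suc j)) + 1) ^ Suc 3" by (simp add: add.commute)
    qed simp
    finally show ?case by simp
  qed
  then show ?thesis by (rule iffD1[OF eventually_sequentially_Suc])
qed

lemma R_le_N: "R j \<le> N j"
  unfolding R_def K_def using floor_sqrt_le order_trans by blast

text \<open>As \<open>l j\<close> is negligible against \<open>N j\<close>, the length
  \<open>l (j + 1)\<close> is at most \<open>(K j + 1) powr (2 * (1 + e))\<close>, while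
  \<open>ln (N (j + 1))\<close> is at least \<open>K j\<close>.\<close>

lemma l_powr_le_ln_N:
  assumes e: "0 < e" "e < 1 / 2"
  shows "\<forall>\<^sub>F j in sequentially. real (l j) powr (1 / 2 - e) \<le> ln (N j)"
proof -
  \<comment> \<open>The exponent of \<open>K j + 1\<close> obtained in the end; it has to stay below
    1 for the comparison with \<open>K j\<close>.\<close>
  define c where "c = 2 * (1 + e) * (1 / 2 - e)"
  have ge0: "0 \<le> 1 / e" using e by simp
  have "c = 1 - e - 2 * e\<^sup>2" by (simp add: c_def algebra_simps power2_eq_square)
  then have c: "c < 1" using e by (simp add: add_pos_pos) (smt (verit) zero_le_power2)
  then have "\<forall>\<^sub>F y in at_top. (y + 1) powr c \<le> (y::real)" by real_asymp
  from eventually_K[OF this] l_powr_le_R[of "1 / e", OF ge0]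
  have "\<forall>\<^sub>F j in sequentially. real (l (Suc j)) powr (1 / 2 - e) \<le> ln (N (Suc j))"
  proof eventually_elim
    case (elim j)
    then have j: "1 \<le> j" by simp
    have lpos: "0 < real (l j)" using l_pos[OF j] by simp
    have Npos: "0 < real (N j)" using N_ge_2[OF j] by simp
    have "real (l j) powr (1 / e) \<le> N j" using elim(2) R_le_N[of j] by linarith
    then have "(real (l j) powr (1 / e)) powr e \<le> N j powr e" using e by (intro powr_mono2) auto
    then have le: "real (l j) \<le> N j powr e" using e lpos by (simp add: powr_powr)
    have "real (l (Suc j)) = real (l j) * N j" by (simp add: l_Suc[OF j])
    also have "\<dots> \<le> N j powr e * N j" using le by (intro mult_right_mono) auto
    also have "\<dots> = N j powr (1 + e)" using Npos by (simp add: powr_add)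
    also have "\<dots> \<le> ((real (K j) + 1) powr 2) powr (1 + e)"
    proof (rule powr_mono2)
      have "real (N j) \<le> real ((K j + 1) ^ 2)" using N_less_K[of j] by (simp only: of_nat_le_iff less_imp_le)
      then show "real (N j) \<le> (real (K j) + 1) powr 2" by (simp add: powr_numeral add.commute)
    qed (use e in auto)
    also have "\<dots> = (real (K j) + 1) powr (2 * (1 + e))" by (simp only: powr_powr)
    finally have "real (l (Suc j)) powr (1 / 2 - e) \<le> ((real (K j) + 1) powr (2 * (1 + e))) powr (1 / 2 - e)"
      using e by (intro powr_mono2) auto
    also have "\<dots> = (real (K j) + 1) powr c" by (simp add: powr_powr c_def)
    also have "\<dots> \<le> ln (exp (real (K j)))" using elim by simp
    also have "\<dots> \<le> ln (N (Suc j))" using exp_K_le[OF j] by (intro ln_mono) auto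
    finally show ?case .
  qed
  then show ?thesis by (rule iffD1[OF eventually_sequentially_Suc])
qed

text \<open>\<open>ln (l (j + 2))\<close> is at most \<open>2 * ln (fact (K j))\<close>, hence at
  most \<open>2 * K j * ln (K j)\<close>, and \<open>l (j + 1)\<close> is at least
  \<open>K j ^ 2\<close>; the exponent \<open>e\<close> absorbs the logarithm.\<close>

lemma ln_l_Suc_le_powr:
  assumes e: "0 < e"
  shows "\<forall>\<^sub>F j in sequentially. ln (l (Suc j)) \<le> real (l j) powr (1 / 2 + e)"
proof -
  have "\<forall>\<^sub>F y in at_top. 2 * (y * ln y) \<le> (y powr 2) powr (1 / 2 + e)"
    using e by real_asymp
  from eventually_K[OF this] have "\<forall>\<^sub>F j in sequentially. ln (l (Suc (Suc j))) \<le> real (l (Suc j)) powr (1 / 2 + e)"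
  proof eventually_elim
    case (elim j)
    then have j: "1 \<le> j" by simp
    have Kpos: "0 < real (K j)" using elim by simp
    have lpos: "0 < real (l (Suc j))" using l_pos[of "Suc j"] by simp
    have le: "real (l (Suc j)) \<le> N (Suc j)" using l_le_N[of "Suc j"] by simp
    have "ln (l (Suc (Suc j))) = ln (l (Suc j)) + ln (N (Suc j))"
      using lpos le by (simp add: l_Suc[of "Suc j"] ln_mult)
    also have "\<dots> \<le> 2 * ln (N (Suc j))" using lpos le by simp
    also have "ln (N (Suc j)) \<le> ln (real (K j) ^ K j)"
    proof -
      have "real (fact (K j)) \<le> real (K j ^ K j)" using fact_le_power[of "K j"] by simp
      then show ?thesis unfolding N_Suc[OF j] by (intro ln_mono) auto
    qed
    also have "\<dots> = K j * ln (K j)" using Kpos by (simp add: ln_realpow)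
    finally have "ln (l (Suc (Suc j))) \<le> 2 * (K j * ln (K j))" by simp
    also have "\<dots> \<le> (real (K j) powr 2) powr (1 / 2 + e)" using elim by simp
    also have "\<dots> \<le> real (l (Suc j)) powr (1 / 2 + e)"
    proof (rule powr_mono2)
      have "K j * K j \<le> l (Suc j)"
        using mult_le_mono[of 1 "l j" "K j * K j" "N j"] l_pos[OF j] K_sq_le[of j] by (simp add: l_Suc[OF j])
      then have "real (K j * K j) \<le> l (Suc j)" by (simp only: of_nat_le_iff)
      then show "real (K j) powr 2 \<le> l (Suc j)" using Kpos by (simp add: powr_numeral power2_eq_square)
    qed (use e in auto)
    finally show ?case .
  qed
  then show ?thesis using eventually_sequentially_Suc[of "\<lambda>j. ln (l (Suc j)) \<le> real (l j) powr (1 / 2 + e)"] by simp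
qed

text \<open>The lengths grow doubly exponentially: \<open>l (j + 2) \<ge> exp (2 ^ j)\<close>. Hence
  dividing \<open>l j\<close> by \<open>2 ^ j\<close>, as in \<open>reach\<close>, does not affect
  exponents.\<close>

lemma power_le_l_powr:
  assumes e: "0 < e"
  shows "\<forall>\<^sub>F j in sequentially. 2 ^ Suc j \<le> real (l j) powr e"
proof -
  have "\<forall>\<^sub>F j in sequentially. 2 ^ (j + 3) \<le> exp (2 ^ j) powr e"
    using e by real_asymp
  then have "\<forall>\<^sub>F j in sequentially. 2 ^ Suc (Suc (Suc j)) \<le> real (l (Suc (Suc j))) powr e"
    using eventually_ge_at_top[of 1]
  proof eventually_elim
    case (elim j)
    then have j: "1 \<le> j" by simp
    have "real (2 ^ j) \<le> K j" using K_ge[OF j] by (simp only: of_nat_le_iff)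
    then have "exp (2 ^ j) \<le> exp (real (K j))" by simp
    also have "\<dots> \<le> N (Suc j)" by (rule exp_K_le[OF j])
    also have "\<dots> \<le> l (Suc (Suc j))"
      using mult_le_mono1[of 1 "l (Suc j)" "N (Suc j)"] l_pos[of "Suc j"]
      by (simp add: l_Suc[of "Suc j"] flip: of_nat_mult)
    finally have "exp (2 ^ j) powr e \<le> real (l (Suc (Suc j))) powr e"
      using e by (intro powr_mono2) auto
    then show ?case using elim(1) by (simp add: power_add)
  qed
  then show ?thesis
    using eventually_sequentially_Suc[of "\<lambda>j. 2 ^ Suc j \<le> real (l j) powr e"]
      eventually_sequentially_Suc[of "\<lambda>j. 2 ^ Suc (Suc j) \<le> real (l (Suc j)) powr e"] by simp
qed

end

section \<open>Measures of words and cylinders\<close>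

locale marker_measure = marker l1 C + prob_space M
  for l1 C and M :: "(int \<Rightarrow> nat) measure" +
  assumes sets_M: "sets M = sets borel"
    and X_full: "emeasure M (marker_shift C) = 1"
    and invariant: "\<And>A. A \<in> sets M \<Longrightarrow> emeasure M (shift_map -` A) = emeasure M A"
begin

lemma space_M: "space M = UNIV"
  using sets_eq_imp_space_eq[OF sets_M] by simp

lemma X_sets [measurable]: "X \<in> sets M"
  using X_full emeasure_notin_sets[of X M] by fastforce

lemma prob_X: "prob X = 1"
  using X_full by (simp add: measure_def)

lemma coordinate_sets: "{y. y i = c} \<in> sets M"
proof -
  have "(\<lambda>y::int \<Rightarrow> nat. y i) \<in> borel_measurable borel"
    by (intro borel_measurable_continuous_onI) simp
  then have "(\<lambda>y::int \<Rightarrow> nat. y i) -` {c} \<inter> space borel \<in> sets borel" by (rule measurable_sets) simp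
  then show ?thesis by (simp add: sets_M vimage_def)
qed

lemma block_sets: "{y. block y p n = w} \<in> sets M"
proof (cases "length w = n")
  case True
  then have "{y. block y p n = w} = {y \<in> space M. \<forall>k\<in>{..<n}. y (p + int k) = w ! k}"
    by (auto simp: list_eq_iff_nth_eq space_M)
  also have "\<dots> \<in> sets M"
    by (rule sets.sets_Collect_finite_All) (auto simp: space_M coordinate_sets)
  finally show ?thesis .
next
  case False
  then have "{y. block y p n = w} = {}" by auto
  then show ?thesis by simp
qed

lemma starts_sets: "{y. p \<in> starts j y} \<in> sets M"
proof -
  have "{y. p \<in> starts j y} = (\<Union>w\<in>set (C j). {y. block y p (l j) = w})" by (auto simp: starts_def)
  then show ?thesis by (simp add: block_sets sets.finite_UN)
qed

lemma cyl_sets: "cyl X n x \<in> sets M"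
proof -
  have "cyl X n x = X \<inter> {y. block y 0 n = block x 0 n}" by (auto simp: cyl_altdef)
  then show ?thesis using block_sets X_sets by (simp add: sets.Int)
qed

section \<open>Consequences of invariance\<close>

lemma shift_measurable: "(\<lambda>y i. y (i + q)) \<in> measurable M M"
proof -
  have "(\<lambda>(y::int \<Rightarrow> nat) i. y (i + q)) \<in> borel_measurable borel"
    by (intro borel_measurable_continuous_onI continuous_on_coordinatewise_then_product) simp
  then show ?thesis using measurable_cong_sets[OF sets_M sets_M] by simp
qed

lemma shift_vimage_sets: "A \<in> sets M \<Longrightarrow> (\<lambda>y i. y (i + q)) -` A \<in> sets M"
  using measurable_sets[OF shift_measurable, of A q] by (simp add: space_M)

text \<open>Nonnegative \<open>q\<close> are reached by iteration. For negative \<open>q\<close>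
  this is applied to the preimage of \<open>A\<close>, whose preimage under the opposite shift is
  \<open>A\<close>.\<close>

lemma prob_shift:
  assumes A: "A \<in> sets M"
  shows "prob ((\<lambda>y i. y (i + q)) -` A) = prob A"
proof -
  have nat: "emeasure M ((\<lambda>y i. y (i + int n)) -` A) = emeasure M A" if A: "A \<in> sets M" for A n
  proof (induction n)
    case (Suc n)
    have "(\<lambda>y i. y (i + int (Suc n))) -` A = shift_map -` ((\<lambda>y i. y (i + int n)) -` A)"
      by (auto simp: shift_map_def ac_simps)
    then show ?case using invariant[OF shift_vimage_sets[OF A]] Suc by simp
  qed simp
  have "emeasure M ((\<lambda>y i. y (i + q)) -` A) = emeasure M A"
  proof (cases "0 \<le> q")
    case True
    then show ?thesis using nat[OF A, of "nat q"] by simp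
  next
    case False
    have "(\<lambda>y i. y (i + int (nat (- q)))) -` ((\<lambda>y i. y (i + q)) -` A) = A"
      using False by auto
    then show ?thesis using nat[OF shift_vimage_sets[OF A], of "nat (- q)" q] by simp
  qed
  then show ?thesis by (simp add: measure_def)
qed

text \<open>\<open>X\<close> is the disjoint union of the \<open>l j\<close> events telling the
  place of coordinate 0 in its word, and these are translates of each other.\<close>

lemma prob_starts:
  assumes j: "1 \<le> j"
  shows "prob {y \<in> X. p \<in> starts j y} = 1 / l j"
proof -
  define S where "S q = {y \<in> X. q \<in> starts j y}" for q
  have S_sets: "S q \<in> sets M" for q
    using sets.Int[OF X_sets starts_sets[of q j]] by (simp add: S_def Int_def)
  have "S q = (\<lambda>y i. y (i + q)) -` S 0" for q
    by (simp add: S_def vimage_def starts_shift X_shift)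
  then have const: "prob (S q) = prob (S 0)" for q using prob_shift[OF S_sets] by metis
  have "X = (\<Union>k\<in>{..<l j}. S (- int k))"
    using starts_ex1[OF _ j] unfolding S_def by blast
  then have "1 = prob (\<Union>k\<in>{..<l j}. S (- int k))" using prob_X by simp
  also have "\<dots> = (\<Sum>k\<in>{..<l j}. prob (S (- int k)))"
  proof (rule finite_measure_finite_Union)
    show "disjoint_family_on (\<lambda>k. S (- int k)) {..<l j}"
      using starts_ex1[OF _ j] unfolding S_def disjoint_family_on_def by blast
  qed (use S_sets in auto)
  also have "\<dots> = l j * prob (S 0)" by (simp add: const[of "- int _"])
  finally have "prob (S 0) = 1 / l j" using l_pos[OF j] by (simp add: field_simps)
  then show ?thesis using const[of p] by (simp add: S_def)
qed

text \<open>Each level-\<open>j\<close> word occurs exactly once in every level-\<open>(j + 1)\<close> word, so its occurrences have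
  the same frequency as the beginnings of level-\<open>(j + 1)\<close> words.\<close>

lemma prob_word:
  assumes j: "1 \<le> j" and u: "u \<in> set (C j)"
  shows "prob {y \<in> X. block y p (l j) = u} = 1 / l (Suc j)"
proof -
  define D where "D q = {y \<in> X. block y q (l j) = u}" for q
  have D_sets: "D q \<in> sets M" for q
    using sets.Int[OF X_sets block_sets[of q "l j" u]] by (simp add: D_def Int_def)
  have "D p = (\<lambda>y i. y (i + p)) -` D 0"
    by (simp add: D_def vimage_def block_shift X_shift)
  then have "prob (D p) = prob (D 0)" using prob_shift[OF D_sets] by metis
  \<comment> \<open>The \<open>A t\<close> split the occurrence of \<open>u\<close> at 0 by its
    number \<open>t\<close> in the surrounding level-\<open>(j + 1)\<close> word. Their translates
    \<open>B t\<close> have that word begin at 0 and split the event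
    \<open>0 \<in> starts (Suc j) y\<close> by the number of the block equal to
    \<open>u\<close>.\<close>
  define A where "A t = {y \<in> X. - int (t * l j) \<in> starts (Suc j) y \<and> block y 0 (l j) = u}" for t
  define B where "B t = {y \<in> X. 0 \<in> starts (Suc j) y \<and> block y (int (t * l j)) (l j) = u}" for t
  have A_sets: "A t \<in> sets M" for t
    using sets.Int[OF D_sets[of 0] starts_sets[of "- int (t * l j)" "Suc j"]]
    by (simp add: A_def D_def Int_def conj_ac)
  have B_sets: "B t \<in> sets M" for t
    using sets.Int[OF D_sets[of "int (t * l j)"] starts_sets[of 0 "Suc j"]]
    by (simp add: B_def D_def Int_def conj_ac)
  have "A t = (\<lambda>y i. y (i + - int (t * l j))) -` B t" for t
    unfolding A_def B_def vimage_def mem_Collect_eq starts_shift X_shift block_shift by simp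
  then have AB: "prob (A t) = prob (B t)" for t using prob_shift[OF B_sets] by metis
  have ex1: "\<exists>!t. t < N j \<and> - int (t * l j) \<in> starts (Suc j) y" if "y \<in> D 0" for y
    using that u by (intro starts_Suc_ex1[OF _ j]) (auto simp: D_def starts_def)
  have "D 0 = (\<Union>t\<in>{..<N j}. A t)"
    using ex1 unfolding D_def A_def by blast
  then have "prob (D 0) = prob (\<Union>t\<in>{..<N j}. A t)" by simp
  also have "\<dots> = (\<Sum>t\<in>{..<N j}. prob (A t))"
  proof (rule finite_measure_finite_Union)
    show "disjoint_family_on A {..<N j}"
      using ex1 unfolding A_def D_def disjoint_family_on_def by blast
  qed (use A_sets in auto)
  also have "\<dots> = (\<Sum>t\<in>{..<N j}. prob (B t))" by (simp add: AB)
  also have "\<dots> = prob (\<Union>t\<in>{..<N j}. B t)"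
  proof (rule finite_measure_finite_Union[symmetric])
    show "disjoint_family_on B {..<N j}"
      unfolding disjoint_family_on_def
    proof (intro ballI impI)
      fix t t' assume t: "t \<in> {..<N j}" "t' \<in> {..<N j}" "t \<noteq> t'"
      show "B t \<inter> B t' = {}"
      proof (rule ccontr)
        assume "B t \<inter> B t' \<noteq> {}"
        then obtain y where y: "y \<in> B t" "y \<in> B t'" by blast
        then have "0 \<in> starts (Suc j) y" by (simp add: B_def)
        from starts_word[OF j this] obtain \<pi> where \<pi>: "\<pi> permutes P j"
          and b: "\<And>t. t < N j \<Longrightarrow> block y (0 + int (t * l j)) (l j) = C j ! (\<pi> (t + 1) - 1)" by blast
        have "C j ! (\<pi> (t + 1) - 1) = C j ! (\<pi> (t' + 1) - 1)"
          using b[of t] b[of t'] t y by (simp add: B_def)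
        moreover have "1 \<le> \<pi> (t + 1)" "\<pi> (t + 1) \<le> N j" "1 \<le> \<pi> (t' + 1)" "\<pi> (t' + 1) \<le> N j"
          using permutes_P_range[OF \<pi> N_ge_2[OF j]] t by simp_all
        ultimately have "\<pi> (t + 1) - 1 = \<pi> (t' + 1) - 1"
          using nth_eq_iff_index_eq[OF distinct_C[OF j], of "\<pi> (t + 1) - 1" "\<pi> (t' + 1) - 1"]
          by (simp add: N_def)
        then have "\<pi> (t + 1) = \<pi> (t' + 1)" using \<open>1 \<le> \<pi> (t + 1)\<close> \<open>1 \<le> \<pi> (t' + 1)\<close> by linarith
        then show False using t(3) injD[OF permutes_inj[OF \<pi>]] by fastforce
      qed
    qed
  qed (use B_sets in auto)
  also have "(\<Union>t\<in>{..<N j}. B t) = {y \<in> X. 0 \<in> starts (Suc j) y}"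
  proof -
    have "\<exists>t<N j. y \<in> B t" if y: "y \<in> X" "0 \<in> starts (Suc j) y" for y
    proof -
      from starts_word[OF j y(2)] obtain \<pi> where \<pi>: "\<pi> permutes P j"
        and b: "\<And>t. t < N j \<Longrightarrow> block y (0 + int (t * l j)) (l j) = C j ! (\<pi> (t + 1) - 1)" by blast
      obtain i where i: "i < N j" "u = C j ! i" using u by (auto simp: in_set_conv_nth N_def)
      \<comment> \<open>The position at which \<open>\<pi>\<close> places the word
        \<open>u\<close>.\<close>
      define s where "s = inv \<pi> (i + 1)"
      have s: "\<pi> s = i + 1" unfolding s_def by (rule permutes_inverses(1)[OF \<pi>])
      have "1 \<le> s" "s \<le> N j"
        unfolding s_def using permutes_P_range[OF permutes_inv[OF \<pi>] N_ge_2[OF j], of "i + 1"] i by auto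
      then show ?thesis using y b[of "s - 1"] s i by (intro exI[of _ "s - 1"]) (simp add: B_def)
    qed
    then show ?thesis unfolding B_def by blast
  qed
  also have "prob \<dots> = 1 / l (Suc j)" using prob_starts[of "Suc j" 0] by simp
  finally show ?thesis using \<open>prob (D p) = prob (D 0)\<close> by (simp add: D_def)
qed

lemma prob_cyl_le:
  assumes x: "x \<in> X" and j: "1 \<le> j" and n: "2 * l j \<le> n"
  shows "prob (cyl X n x) \<le> 1 / l (Suc j)"
proof -
  obtain k where k: "k < l j" "- int k \<in> starts j x" using starts_ex1[OF x j] by blast
  obtain r where r: "\<And>p. p \<in> starts j x \<longleftrightarrow> int (l j) dvd p - r"
    using starts_residue[OF x j] by blast
  \<comment> \<open>The first beginning of a level-\<open>j\<close> word to the right of 0; it is at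
    most \<open>l j\<close>, so the word ends within the first \<open>2 * l j\<close>
    places.\<close>
  define d where "d = l j - k"
  have d: "int d = int (l j) + (- int k)" "d + l j \<le> n" using k(1) n by (auto simp: d_def)
  have "int (l j) dvd int (l j) + (- int k - r)" using k(2) r by (intro dvd_add) auto
  then have "int d \<in> starts j x" unfolding r d(1) by (simp add: algebra_simps)
  then have u: "block x (int d) (l j) \<in> set (C j)" by (simp add: starts_def)
  have "cyl X n x \<subseteq> {y \<in> X. block y (int d) (l j) = block x (int d) (l j)}"
  proof
    fix y assume y: "y \<in> cyl X n x"
    have "block y (int d) (l j) = take (l j) (drop d (block y 0 n))"
      using take_drop_block[OF d(2), of y 0] by simp
    also have "\<dots> = block x (int d) (l j)"
      using y take_drop_block[OF d(2), of x 0] by (simp add: cyl_altdef)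
    finally show "y \<in> {y \<in> X. block y (int d) (l j) = block x (int d) (l j)}"
      using y by (simp add: cyl_altdef)
  qed
  moreover have "{y \<in> X. block y (int d) (l j) = block x (int d) (l j)} \<in> sets M"
    using sets.Int[OF X_sets block_sets[of "int d" "l j" "block x (int d) (l j)"]] by (simp add: Int_def)
  ultimately have "prob (cyl X n x) \<le> prob {y \<in> X. block y (int d) (l j) = block x (int d) (l j)}"
    by (rule finite_measure_mono)
  also have "\<dots> = 1 / l (Suc j)" by (rule prob_word[OF j u])
  finally show ?thesis .
qed

text \<open>Permuting the positions outside \<open>hits\<close> does not change the window, and all the resulting
  level-\<open>(j + 1)\<close> words have the same measure.\<close>

lemma prob_cyl_ge:
  assumes x: "x \<in> X" and j: "1 \<le> j" and k: "- int k \<in> starts (Suc j) x" "k + n \<le> l (Suc j)"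
  shows "fact (K j - card (hits j k n)) / (l (Suc j) * fact (K j)) \<le> prob (cyl X n x)"
proof -
  let ?Q = "P j - hits j k n"
  obtain \<pi> where \<pi>: "\<pi> permutes P j" "block x (- int k) (l (Suc j)) = word j \<pi>"
    using starts_word[OF j k(1)] by blast
  define W where "W = (\<lambda>\<rho>. word j (\<pi> \<circ> \<rho>)) ` {\<rho>. \<rho> permutes ?Q}"
  have \<pi>\<rho>: "(\<pi> \<circ> \<rho>) permutes P j" if "\<rho> permutes ?Q" for \<rho>
    using permutes_compose[OF permutes_subset[OF that] \<pi>(1)] by blast
  have inj_word: "inj_on (word j) {\<pi>. \<pi> permutes P j}"
    by (rule inj_on_word[OF j N_ge_2[OF j]]) (rule length_C[OF j])
  have "inj_on (\<lambda>\<rho>. word j (\<pi> \<circ> \<rho>)) {\<rho>. \<rho> permutes ?Q}"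
  proof (rule inj_onI)
    fix \<rho> \<sigma> assume *: "\<rho> \<in> {\<rho>. \<rho> permutes ?Q}" "\<sigma> \<in> {\<rho>. \<rho> permutes ?Q}"
      and eq: "word j (\<pi> \<circ> \<rho>) = word j (\<pi> \<circ> \<sigma>)"
    have "\<pi> \<circ> \<rho> = \<pi> \<circ> \<sigma>"
      by (rule inj_onD[OF inj_word, OF eq]) (use * \<pi>\<rho> in auto)
    then show "\<rho> = \<sigma>" using permutes_inj[OF \<pi>(1)] by (simp add: fun_eq_iff inj_eq)
  qed
  then have "card W = card {\<rho>. \<rho> permutes ?Q}" unfolding W_def by (rule card_image)
  also have "\<dots> = fact (card ?Q)" by (intro card_permutations) auto
  also have "card ?Q = K j - card (hits j k n)"
    using card_P[OF j] by (subst card_Diff_subset) (auto simp: hits_def)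
  finally have card_W: "card W = fact (K j - card (hits j k n))" .
  have W_C: "w \<in> set (C (Suc j))" if "w \<in> W" for w
    using that \<pi>\<rho> unfolding W_def set_C_Suc[OF j] by blast
  have finW: "finite W" unfolding W_def by (intro finite_imageI finite_permutations) simp
  define D where "D w = {y \<in> X. block y (- int k) (l (Suc j)) = w}" for w
  have D_sets: "D w \<in> sets M" for w
    using sets.Int[OF X_sets block_sets[of "- int k" "l (Suc j)" w]] by (simp add: D_def Int_def)
  have sub: "(\<Union>w\<in>W. D w) \<subseteq> cyl X n x"
  proof
    fix y assume "y \<in> (\<Union>w\<in>W. D w)"
    then obtain \<rho> where y: "y \<in> X" and \<rho>: "\<rho> permutes ?Q"
      and b: "block y (- int k) (l (Suc j)) = word j (\<pi> \<circ> \<rho>)"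
      by (auto simp: D_def W_def)
    have "y (int i) = x (int i)" if "i < n" for i
    proof -
      have i: "k + i < l (Suc j)" using that k(2) by simp
      have "y (int i) = block y (- int k) (l (Suc j)) ! (k + i)" using i by simp
      also have "\<dots> = block x (- int k) (l (Suc j)) ! (k + i)"
        unfolding b \<pi>(2) by (rule word_agree_off_hits[OF j \<pi>(1) \<rho>]) (use that i in auto)
      finally show ?thesis using i by simp
    qed
    then show "y \<in> cyl X n x" using y by (simp add: cyl_def)
  qed
  \<comment> \<open>\<open>prob_word\<close> is used one level higher: each word in \<open>W\<close>
    has measure \<open>1 / l (j + 2)\<close>, and
    \<open>l (j + 2) = l (j + 1) * fact (K j)\<close>.\<close>
  have "fact (K j - card (hits j k n)) / (l (Suc j) * fact (K j)) = card W * (1 / l (Suc (Suc j)))"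
    unfolding card_W by (simp add: l_Suc[of "Suc j"] N_Suc[OF j])
  also have "\<dots> = (\<Sum>w\<in>W. prob (D w))"
    using prob_word[of "Suc j" _ "- int k"] W_C by (simp add: D_def)
  also have "\<dots> = prob (\<Union>w\<in>W. D w)"
    by (rule finite_measure_finite_Union[symmetric])
       (use finW D_sets in \<open>auto simp: disjoint_family_on_def D_def\<close>)
  also have "\<dots> \<le> prob (cyl X n x)" by (rule finite_measure_mono[OF sub cyl_sets])
  finally show ?thesis .
qed

section \<open>The information of a cylinder\<close>

text \<open>Since \<open>ln 0 = 0\<close>, a null cylinder would get the value 0. Lower bounds
  therefore assume positive measure, which \<open>H_le\<close> provides.\<close>

definition H :: "nat \<Rightarrow> (int \<Rightarrow> nat) \<Rightarrow> real" where
  "H n x = - ln (prob (cyl X n x))"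

lemma H_nonneg: "0 \<le> H n x"
proof (cases "prob (cyl X n x) = 0")
  case False
  then have "0 < prob (cyl X n x)" using measure_nonneg[of M "cyl X n x"] by linarith
  then show ?thesis by (simp add: H_def)
qed (simp add: H_def)

text \<open>Keeping the \<open>c\<close> hit positions fixed leaves at least the fraction
  \<open>1 / K j ^ c\<close> of all permutations, so each hit costs at most
  \<open>ln (K j)\<close>.\<close>

lemma H_le:
  assumes x: "x \<in> X" and j: "1 \<le> j" and k: "- int k \<in> starts (Suc j) x" "k + n \<le> l (Suc j)"
  shows "0 < prob (cyl X n x)" "H n x \<le> ln (l (Suc j)) + card (hits j k n) * ln (K j)"
proof -
  define c where "c = card (hits j k n)"
  have cK: "c \<le> K j" unfolding c_def by (rule card_hits_le_K[OF j])
  have Kpos: "0 < real (K j)" using K_ge_8[OF N_ge_64[OF j]] by simp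
  have lpos: "0 < real (l (Suc j))" using l_pos[of "Suc j"] by simp
  have "real (fact (K j)) \<le> real (K j ^ c * fact (K j - c))"
    using fact_le_power_mult_fact[OF cK] by (simp only: of_nat_le_iff)
  then have "fact (K j) \<le> real (K j) ^ c * fact (K j - c)" by simp
  then have "1 / (l (Suc j) * real (K j) ^ c) \<le> fact (K j - c) / (l (Suc j) * fact (K j))"
    using lpos Kpos by (simp add: field_simps)
  also have "\<dots> \<le> prob (cyl X n x)" unfolding c_def by (rule prob_cyl_ge[OF assms])
  finally have le: "1 / (l (Suc j) * real (K j) ^ c) \<le> prob (cyl X n x)" .
  have pos: "0 < 1 / (l (Suc j) * real (K j) ^ c)" using lpos Kpos by simp
  with le show "0 < prob (cyl X n x)" by linarith
  have "ln (1 / (l (Suc j) * real (K j) ^ c)) \<le> ln (prob (cyl X n x))"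
    using pos le by (simp only: ln_le_cancel_iff less_le_trans[OF pos le])
  then show "H n x \<le> ln (l (Suc j)) + card (hits j k n) * ln (K j)"
    using lpos Kpos by (simp add: H_def ln_div ln_mult ln_realpow c_def)
qed

lemma H_ge:
  assumes "x \<in> X" "1 \<le> j" "2 * l j \<le> n" "0 < prob (cyl X n x)"
  shows "ln (l (Suc j)) \<le> H n x"
proof -
  have "ln (prob (cyl X n x)) \<le> ln (1 / l (Suc j))"
    using prob_cyl_le[OF assms(1-3)] assms(4) by (subst ln_le_cancel_iff) (auto simp: l_pos)
  then show ?thesis using l_pos[of "Suc j"] by (simp add: H_def ln_div)
qed

section \<open>Information of typical points\<close>

definition Bad :: "nat \<Rightarrow> (int \<Rightarrow> nat) set" where
  "Bad j = (\<Union>k\<in>bad j. {x \<in> X. - int k \<in> starts (Suc j) x})"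

text \<open>The index \<open>Suc j\<close> keeps the levels at least 1, so that
  \<open>prob_Bad\<close> bounds every term of the series in the Borel-Cantelli argument.\<close>

definition typical :: "(int \<Rightarrow> nat) set" where
  "typical = {x \<in> X. \<forall>\<^sub>F j in sequentially. x \<notin> Bad (Suc j)}"

lemma finite_bad: "finite (bad j)"
  by (rule finite_subset[of _ "{..<l (Suc j)}"]) (auto simp: bad_def)

lemma X_starts_sets: "{x \<in> X. p \<in> starts j x} \<in> sets M"
  using sets.Int[OF X_sets starts_sets[of p j]] by (simp add: Int_def)

lemma Bad_sets: "Bad j \<in> sets M"
  unfolding Bad_def using finite_bad X_starts_sets by (intro sets.finite_UN) auto

lemma prob_Bad:
  assumes j: "1 \<le> j"
  shows "prob (Bad j) \<le> 3 * (1 / 2) ^ j"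
proof -
  have "prob (Bad j) \<le> (\<Sum>k\<in>bad j. prob {x \<in> X. - int k \<in> starts (Suc j) x})"
    unfolding Bad_def using finite_bad X_starts_sets
    by (intro finite_measure_subadditive_finite) auto
  also have "\<dots> = card (bad j) / l (Suc j)" by (simp add: prob_starts)
  also have "\<dots> \<le> 3 * (1 / 2) ^ j" by (rule card_bad_ratio[OF j])
  finally show ?thesis .
qed

lemma AE_typical: "AE x in M. x \<in> typical"
proof -
  have "summable (\<lambda>j. prob (Bad (Suc j)))"
  proof (rule summable_comparison_test')
    show "summable (\<lambda>j. 3 * (1 / 2 :: real) ^ Suc j)"
      by (intro summable_mult summable_ignore_initial_segment[of _ 1, simplified] summable_geometric) simp
    show "norm (prob (Bad (Suc j))) \<le> 3 * (1 / 2) ^ Suc j" if "0 \<le> j" for j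
      using prob_Bad[of "Suc j"] by simp
  qed
  then have "AE x in M. \<forall>\<^sub>F j in sequentially. x \<in> space M - Bad (Suc j)"
    by (intro borel_cantelli_AE1 Bad_sets) (simp_all add: emeasure_eq_measure)
  moreover have "AE x in M. x \<in> X"
    using prob_X X_sets by (simp add: AE_in_set_eq_1)
  ultimately show ?thesis
    by eventually_elim (auto simp: typical_def elim: eventually_mono)
qed

lemma typical_sets: "typical \<in> sets M"
proof -
  have "typical = X \<inter> {x \<in> space M. \<exists>J. \<forall>j. J \<le> j \<longrightarrow> x \<notin> Bad (Suc j)}"
    by (auto simp: typical_def eventually_sequentially space_M)
  also have "\<dots> \<in> sets M"
  proof (intro sets.Int X_sets sets.sets_Collect_countable_Ex sets.sets_Collect_countable_All sets.sets_Collect)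
    show "{x \<in> space M. x \<in> Bad (Suc j)} \<in> sets M" for j
      using Bad_sets[of "Suc j"] by (simp add: space_M)
  qed
  finally show ?thesis .
qed

lemma emeasure_typical: "emeasure M typical = 1"
  using AE_typical AE_in_set_eq_1[OF typical_sets] by (simp add: emeasure_eq_measure)

lemma typical_X: "x \<in> typical \<Longrightarrow> x \<in> X"
  by (simp add: typical_def)

lemma typical_start:
  assumes x: "x \<in> typical"
  shows "\<forall>\<^sub>F j in sequentially. 1 \<le> j \<and>
    (\<exists>k. - int k \<in> starts (Suc j) x \<and> k + reach (Suc j) \<le> l (Suc j) \<and> hits j k (l j * R j) = {})"
proof -
  have "\<forall>\<^sub>F j in sequentially. x \<notin> Bad (Suc j)" using x by (simp add: typical_def)
  then have "\<forall>\<^sub>F j in sequentially. x \<notin> Bad j" by (rule iffD1[OF eventually_sequentially_Suc])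
  then show ?thesis using eventually_ge_at_top[of 1]
  proof eventually_elim
    case (elim j)
    obtain k where k: "k < l (Suc j)" "- int k \<in> starts (Suc j) x"
      using starts_ex1[OF typical_X[OF x], of "Suc j"] by auto
    then have "k \<notin> bad j" using elim(1) typical_X[OF x] by (auto simp: Bad_def)
    then show ?case using k elim(2) by (auto simp: bad_def not_less)
  qed
qed

text \<open>Without hits the upper bound of \<open>H_le\<close> meets the lower bound of
  \<open>H_ge\<close>.\<close>

lemma H_short_window:
  assumes x: "x \<in> typical"
  shows "\<forall>\<^sub>F j in sequentially. \<forall>n. 2 * l j \<le> n \<and> n \<le> l j * R j \<longrightarrow> H n x = ln (l (Suc j))"
  using typical_start[OF x]
proof eventually_elim
  case (elim j)
  show ?case
  proof (intro allI impI)
    fix n assume n: "2 * l j \<le> n \<and> n \<le> l j * R j"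
    from elim obtain k where j: "1 \<le> j" and k: "- int k \<in> starts (Suc j) x"
      "k + reach (Suc j) \<le> l (Suc j)" "hits j k (l j * R j) = {}" by blast
    have "hits j k n \<subseteq> hits j k (l j * R j)" using n by (auto simp: hits_def)
    then have hits: "hits j k n = {}" using k(3) by blast
    have "k + n \<le> l (Suc j)" using k(2) n window_le_reach[OF j] by linarith
    from H_le[OF typical_X[OF x] j k(1) this] hits
    have "0 < prob (cyl X n x)" "H n x \<le> ln (l (Suc j))" by simp_all
    then show "H n x = ln (l (Suc j))"
      using H_ge[OF typical_X[OF x] j] n by fastforce
  qed
qed

text \<open>There are at most \<open>3 + sqrt (n / l j)\<close> hits, each costing
  \<open>ln (K j) \<le> ln (l (j + 1))\<close>; the place of the window in its word accounts for one
  more such term.\<close>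

lemma H_long_window:
  assumes x: "x \<in> typical"
  shows "\<forall>\<^sub>F j in sequentially. \<forall>n. n \<le> reach (Suc j) \<longrightarrow> H n x \<le> ln (l (Suc j)) * (4 + sqrt (n / l j))"
  using typical_start[OF x]
proof eventually_elim
  case (elim j)
  show ?case
  proof (intro allI impI)
    fix n assume n: "n \<le> reach (Suc j)"
    from elim obtain k where j: "1 \<le> j" and k: "- int k \<in> starts (Suc j) x"
      "k + reach (Suc j) \<le> l (Suc j)" by blast
    have Kpos: "0 < real (K j)" using K_ge_8[OF N_ge_64[OF j]] by simp
    have "K j \<le> N j" unfolding K_def by (rule floor_sqrt_le)
    moreover have "1 * N j \<le> l j * N j" using l_pos[OF j] by (intro mult_le_mono1) simp
    ultimately have "K j \<le> l (Suc j)" unfolding l_Suc[OF j] by linarith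
    then have lnK: "ln (K j) \<le> ln (l (Suc j))" using Kpos by simp
    have "(floor_sqrt (n div l j + 1)) ^ 2 \<le> n div l j + 1" by (rule floor_sqrt_power2_le)
    then have "real (floor_sqrt (n div l j + 1) ^ 2) \<le> real (n div l j + 1)" by (simp only: of_nat_le_iff)
    then have "real (floor_sqrt (n div l j + 1)) ^ 2 \<le> real (n div l j) + 1" by simp
    also have "real (n div l j) \<le> n / l j" by (rule of_nat_div_le_of_nat)
    finally have "real (floor_sqrt (n div l j + 1)) \<le> sqrt (n / l j + 1)" by (intro real_le_rsqrt) simp
    also have "\<dots> \<le> sqrt (n / l j) + sqrt 1" by (rule sqrt_add_le_add_sqrt) auto
    finally have "real (card (hits j k n)) \<le> 3 + sqrt (n / l j)"
      using card_hits_le[OF j, of k n] by simp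
    then have "card (hits j k n) * ln (K j) \<le> (3 + sqrt (n / l j)) * ln (l (Suc j))"
      using lnK Kpos K_ge_8[OF N_ge_64[OF j]] by (intro mult_mono) auto
    moreover have "H n x \<le> ln (l (Suc j)) + card (hits j k n) * ln (K j)"
      using H_le(2)[OF typical_X[OF x] j k(1)] k(2) n by simp
    ultimately show "H n x \<le> ln (l (Suc j)) * (4 + sqrt (n / l j))" by (simp add: algebra_simps)
  qed
qed

section \<open>Information along sequences of lengths\<close>

lemma filterlim_l_powr: "0 < d \<Longrightarrow> 0 < c \<Longrightarrow> filterlim (\<lambda>j. c * real (l j) powr d) at_top sequentially"
proof -
  assume "0 < d" "0 < c"
  then have "filterlim (\<lambda>y::real. c * y powr d) at_top at_top" by real_asymp
  then show ?thesis using filterlim_l by (rule filterlim_compose)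
qed

lemma tendsto_l_neg_powr: "0 < d \<Longrightarrow> (\<lambda>j. c * real (l j) powr (- d)) \<longlonglongrightarrow> 0"
  using tendsto_mult_right_zero[OF tendsto_neg_powr[OF _ filterlim_l]] by simp

lemma H_quotient_at_top:
  assumes x: "x \<in> typical" and \<beta>: "0 < \<beta>" and A: "0 \<le> A" "A * \<beta> < 1 / 2"
    and window: "\<forall>\<^sub>F j in sequentially. 2 * l j \<le> n j \<and> n j \<le> l j * R j"
    and le: "\<forall>\<^sub>F j in sequentially. real (n j) \<le> 4 * real (l j) powr A"
  shows "filterlim (\<lambda>j. H (n j) x / real (n j) powr \<beta>) at_top sequentially"
proof -
  \<comment> \<open>Half the gap, so that \<open>1 / 2 - e - A * \<beta> = e\<close>: half of the
    gap pays for the error in the exponent of \<open>H\<close>, the other half remains as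
    growth.\<close>
  define e where "e = (1 / 2 - A * \<beta>) / 2"
  have "0 \<le> A * \<beta>" using A(1) \<beta> by simp
  then have e: "0 < e" "e < 1 / 2" using A(2) by (simp_all add: e_def)
  have "filterlim (\<lambda>j. (1 / 4 powr \<beta>) * real (l j) powr e) at_top sequentially"
    using e by (intro filterlim_l_powr) auto
  moreover have "\<forall>\<^sub>F j in sequentially. (1 / 4 powr \<beta>) * real (l j) powr e \<le> H (n j) x / real (n j) powr \<beta>"
    using H_short_window[OF x] window le l_powr_le_ln_N[OF e] eventually_ge_at_top[of 1]
  proof eventually_elim
    case (elim j)
    have lpos: "0 < real (l j)" using l_pos[of j] elim(5) by simp
    have Npos: "0 < real (N j)" using N_ge_2[of j] elim(5) by simp
    have npos: "0 < real (n j)" using elim(2) lpos by simp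
    have "real (l j) powr (1 / 2 - e) \<le> ln (N j)" by (rule elim(4))
    also have "\<dots> \<le> ln (l (Suc j))"
    proof -
      have "1 * real (N j) \<le> real (l j) * N j" using lpos Npos by (intro mult_right_mono) auto
      then show ?thesis using Npos elim(5) by (intro ln_mono) (auto simp: l_Suc)
    qed
    also have "\<dots> = H (n j) x" using elim(1,2) by simp
    finally have H: "real (l j) powr (1 / 2 - e) \<le> H (n j) x" .
    have "real (n j) powr \<beta> \<le> (4 * real (l j) powr A) powr \<beta>"
      using elim(3) \<beta> by (intro powr_mono2) auto
    also have "\<dots> = 4 powr \<beta> * real (l j) powr (A * \<beta>)" by (simp add: powr_mult powr_powr)
    finally have n: "real (n j) powr \<beta> \<le> 4 powr \<beta> * real (l j) powr (A * \<beta>)" .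
    have "(1 / 4 powr \<beta>) * real (l j) powr e
        = real (l j) powr (1 / 2 - e) / (4 powr \<beta> * real (l j) powr (A * \<beta>))"
      by (simp add: e_def field_simps flip: powr_diff powr_add)
    also have "\<dots> \<le> H (n j) x / real (n j) powr \<beta>"
      using H n npos by (intro frac_le H_nonneg) auto
    finally show ?case .
  qed
  ultimately show ?thesis by (rule filterlim_at_top_mono)
qed

lemma H_quotient_zero:
  assumes x: "x \<in> typical" and \<beta>: "0 < \<beta>" and A: "1 / 2 < A * \<beta>"
    and window: "\<forall>\<^sub>F j in sequentially. 2 * l j \<le> n j \<and> n j \<le> l j * R j"
    and ge: "\<forall>\<^sub>F j in sequentially. real (l j) powr A \<le> n j"
  shows "(\<lambda>j. H (n j) x / real (n j) powr \<beta>) \<longlonglongrightarrow> 0"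
proof -
  \<comment> \<open>Again half the gap, now giving
    \<open>1 / 2 + e - A * \<beta> = - e\<close>.\<close>
  define e where "e = (A * \<beta> - 1 / 2) / 2"
  have e: "0 < e" using A by (simp add: e_def)
  have "\<forall>\<^sub>F j in sequentially. H (n j) x / real (n j) powr \<beta> \<le> 1 * real (l j) powr (- e)"
    using H_short_window[OF x] window ge ln_l_Suc_le_powr[OF e] eventually_ge_at_top[of 1]
  proof eventually_elim
    case (elim j)
    have lpos: "0 < real (l j)" using l_pos[of j] elim(5) by simp
    have H: "H (n j) x \<le> real (l j) powr (1 / 2 + e)" using elim(1,2,4) by simp
    have "(real (l j) powr A) powr \<beta> \<le> real (n j) powr \<beta>"
      using elim(3) \<beta> by (intro powr_mono2) auto
    then have n: "real (l j) powr (A * \<beta>) \<le> real (n j) powr \<beta>" by (simp add: powr_powr)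
    have "H (n j) x / real (n j) powr \<beta> \<le> real (l j) powr (1 / 2 + e) / real (l j) powr (A * \<beta>)"
      using H n lpos by (intro frac_le H_nonneg) auto
    also have "\<dots> = real (l j) powr (1 / 2 + e - A * \<beta>)" by (simp add: powr_diff)
    also have "1 / 2 + e - A * \<beta> = - e" by (simp add: e_def field_simps)
    finally show ?case by simp
  qed
  from tendsto_sandwich[OF _ this tendsto_const tendsto_l_neg_powr[OF e]] show ?thesis
    by (simp add: H_nonneg)
qed

lemma reach_unbounded: "\<exists>j\<ge>J. n \<le> reach (Suc j)"
proof -
  have "\<forall>\<^sub>F j in sequentially. real n \<le> real (l j) \<and> J \<le> j \<and> 1 \<le> j"
    using filterlim_l[unfolded filterlim_at_top, rule_format, of "real n"]
      eventually_ge_at_top[of J] eventually_ge_at_top[of 1]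
    by eventually_elim blast
  then obtain j where j: "n \<le> l j" "J \<le> j" "1 \<le> j"
    by (auto dest: eventually_happens)
  have "l j * 1 \<le> l j * R j" using R_pos[OF j(3)] by (intro mult_le_mono) auto
  then have "n \<le> reach (Suc j)" using j window_le_reach[OF j(3)] by linarith
  then show ?thesis using j by blast
qed

text \<open>Between \<open>reach j\<close> and \<open>reach (j + 1)\<close> the length
  \<open>n\<close> is at least \<open>l j powr (1 - e)\<close>, and \<open>H n x\<close> is at most
  \<open>4 * l j powr (1 / 2 + e) + sqrt n * l j powr e\<close>. Both summands, divided by
  \<open>n powr \<beta>\<close>, decrease in \<open>n\<close>, so the lower bound for
  \<open>n\<close> settles them.\<close>

lemma H_quotient_long:
  assumes x: "x \<in> typical" and \<beta>: "1 / 2 < \<beta>"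
  shows "(\<lambda>n. H n x / real n powr \<beta>) \<longlonglongrightarrow> 0"
proof -
  define d where "d = (\<beta> - 1 / 2) / 2"
  \<comment> \<open>Chosen so that the exponent of the first summand becomes exactly
    \<open>- d\<close>.\<close>
  define e where "e = d / (1 + \<beta>)"
  have d: "0 < d" using \<beta> by (simp add: d_def)
  have e: "0 < e" using d \<beta> by (simp add: e_def)
  have ed: "1 / 2 + e - \<beta> * (1 - e) = - d"
  proof -
    have "e * (1 + \<beta>) = d" using \<beta> by (simp add: e_def)
    moreover have "1 / 2 + e - \<beta> * (1 - e) = 1 / 2 - \<beta> + e * (1 + \<beta>)" by (simp add: algebra_simps)
    moreover have "2 * d = \<beta> - 1 / 2" by (simp add: d_def)
    ultimately show ?thesis by linarith
  qed
  have level: "\<forall>\<^sub>F j in sequentially. \<forall>n. reach j \<le> n \<and> n \<le> reach (Suc j) \<longrightarrow>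
      H n x / real n powr \<beta> \<le> 5 * real (l j) powr (- d)"
    using H_long_window[OF x] ln_l_Suc_le_powr[OF e] power_le_l_powr[OF e] power_le_l_powr[of 1, simplified]
      eventually_ge_at_top[of 1]
  proof eventually_elim
    case (elim j)
    show ?case
    proof (intro allI impI)
      fix n assume n: "reach j \<le> n \<and> n \<le> reach (Suc j)"
      have l3: "3 \<le> real (l j)" using l_ge_3[of j] elim(5) by simp
      then have lpos: "0 < real (l j)" by linarith
      define L where "L = real (l j)"
      have L: "1 \<le> L" "0 < L" using l3 by (auto simp: L_def)
      have "real (l j) < (real n + 1) * 2 ^ j"
      proof -
        have "l j < 2 ^ j * (reach j + 1)"
          using dividend_less_times_div[of "2 ^ j" "l j"] by (simp add: reach_def)
        also have "\<dots> \<le> 2 ^ j * (n + 1)" using n by (intro mult_le_mono2) simp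
        finally have "l j < (n + 1) * 2 ^ j" by (simp only: mult.commute)
        then have "real (l j) < real ((n + 1) * 2 ^ j)" by (simp only: of_nat_less_iff)
        then show ?thesis by (simp add: algebra_simps)
      qed
      then have "L < real n * 2 ^ j + 2 ^ j" by (simp add: L_def algebra_simps)
      \<comment> \<open>This absorbs the summand \<open>2 ^ j\<close> caused by the rounding in
        \<open>reach j\<close>.\<close>
      moreover have "2 * 2 ^ j \<le> L" using elim(4) by (simp add: L_def)
      ultimately have "L \<le> real n * 2 ^ Suc j" by simp
      also have "\<dots> \<le> real n * L powr e" using elim(3) by (intro mult_left_mono) (auto simp: L_def)
      finally have "L / L powr e \<le> n" using L by (simp add: field_simps)
      moreover have "L / L powr e = L powr (1 - e)" using L by (simp add: powr_diff)
      ultimately have nL: "L powr (1 - e) \<le> n" by simp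
      then have npos: "0 < real n" using L less_le_trans[of 0 "L powr (1 - e)" "real n"] by simp
      have b1: "L powr (\<beta> * (1 - e)) \<le> real n powr \<beta>"
      proof -
        have "(L powr (1 - e)) powr \<beta> \<le> real n powr \<beta>" using nL \<beta> by (intro powr_mono2) auto
        then show ?thesis by (simp add: powr_powr mult.commute)
      qed
      have b2: "L powr ((\<beta> - 1 / 2) * (1 - e)) \<le> real n powr (\<beta> - 1 / 2)"
      proof -
        have "(L powr (1 - e)) powr (\<beta> - 1 / 2) \<le> real n powr (\<beta> - 1 / 2)"
          using nL \<beta> by (intro powr_mono2) auto
        then show ?thesis by (simp add: powr_powr mult.commute)
      qed
      have "H n x \<le> ln (l (Suc j)) * (4 + sqrt (n / L))" using elim(1) n by (simp add: L_def)
      also have "\<dots> \<le> L powr (1 / 2 + e) * (4 + sqrt (n / L))"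
        using elim(2) L by (intro mult_right_mono) (auto simp: L_def)
      also have "sqrt (n / L) = real n powr (1 / 2) / L powr (1 / 2)"
        using L by (simp add: real_sqrt_divide powr_half_sqrt)
      also have "L powr (1 / 2 + e) * (4 + real n powr (1 / 2) / L powr (1 / 2))
          = 4 * L powr (1 / 2 + e) + real n powr (1 / 2) * L powr e"
      proof -
        have "a * b * (4 + c / a) = 4 * (a * b) + c * b" if "a \<noteq> 0" for a b c :: real
          using that by (simp add: field_simps)
        from this[of "L powr (1 / 2)"] show ?thesis unfolding powr_add using L(2) by simp
      qed
      finally have "H n x / real n powr \<beta>
          \<le> (4 * L powr (1 / 2 + e) + real n powr (1 / 2) * L powr e) / real n powr \<beta>"
        by (intro divide_right_mono) auto
      also have "\<dots> = 4 * (L powr (1 / 2 + e) / real n powr \<beta>) + L powr e / real n powr (\<beta> - 1 / 2)"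
        using npos by (simp add: add_divide_distrib powr_diff)
      also have "\<dots> \<le> 4 * (L powr (1 / 2 + e) / L powr (\<beta> * (1 - e)))
          + L powr e / L powr ((\<beta> - 1 / 2) * (1 - e))"
        using b1 b2 L npos by (intro add_mono mult_left_mono divide_left_mono) auto
      also have "\<dots> = 4 * L powr (- d) + L powr (e - (\<beta> - 1 / 2) * (1 - e))"
        unfolding powr_diff[symmetric] ed ..
      \<comment> \<open>The exponent on the left is \<open>- d - e / 2\<close>.\<close>
      also have "L powr (e - (\<beta> - 1 / 2) * (1 - e)) \<le> L powr (- d)"
      proof (rule powr_mono)
        show "e - (\<beta> - 1 / 2) * (1 - e) \<le> - d"
          using e unfolding ed[symmetric] by (simp add: algebra_simps)
      qed (use L in simp)
      finally show "H n x / real n powr \<beta> \<le> 5 * real (l j) powr (- d)" by (simp add: L_def)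
    qed
  qed
  show ?thesis
  proof (rule LIMSEQ_I)
    fix r :: real assume r: "0 < r"
    have "\<forall>\<^sub>F j in sequentially. 5 * real (l j) powr (- d) < r"
      using order_tendstoD(2)[OF tendsto_l_neg_powr[OF d] r] .
    with level have "\<forall>\<^sub>F j in sequentially. \<forall>n. reach j \<le> n \<and> n \<le> reach (Suc j) \<longrightarrow> H n x / real n powr \<beta> < r"
      by eventually_elim (blast intro: le_less_trans)
    then obtain J where
      J: "\<And>j n. J \<le> j \<Longrightarrow> reach j \<le> n \<Longrightarrow> n \<le> reach (Suc j) \<Longrightarrow> H n x / real n powr \<beta> < r"
      unfolding eventually_sequentially by blast
    have "norm (H n x / real n powr \<beta> - 0) < r" if n: "reach J \<le> n" for n
    proof -
      \<comment> \<open>The least level whose interval extends to \<open>n\<close>; minimality gives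
        \<open>reach j \<le> n\<close> without monotonicity of \<open>reach\<close>.\<close>
      define j where "j = (LEAST j. J \<le> j \<and> n \<le> reach (Suc j))"
      have j: "J \<le> j \<and> n \<le> reach (Suc j)"
        unfolding j_def by (rule LeastI_ex[OF reach_unbounded])
      have "reach j \<le> n"
      proof (cases "j = J")
        case False
        with j obtain i where i: "j = Suc i" "J \<le> i" by (cases j) auto
        have "\<not> (J \<le> i \<and> n \<le> reach (Suc i))"
          using not_less_Least[of i "\<lambda>j. J \<le> j \<and> n \<le> reach (Suc j)"] i(1) unfolding j_def by simp
        then show ?thesis using i by simp
      qed (use n in simp)
      then have "H n x / real n powr \<beta> < r" using J j by blast
      then show ?thesis using H_nonneg[of n x] by simp
    qed
    then show "\<exists>n0. \<forall>n\<ge>n0. norm (H n x / real n powr \<beta> - 0) < r" by blast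
  qed
qed

lemma R_ge_2: "\<forall>\<^sub>F j in sequentially. 2 \<le> R j"
  using eventually_ge_at_top[of 1]
proof eventually_elim
  case (elim j)
  then have "2 ^ 1 \<le> (2 ^ j :: nat)" by (intro power_increasing) auto
  then show ?case using R_ge[OF elim] by simp
qed

section \<open>Critical values\<close>

lemma critical_value_limsup:
  assumes x: "x \<in> typical"
  shows "has_critical_value (\<lambda>\<beta>. limsup (\<lambda>n. ereal (H n x / real n powr \<beta>))) (1 / 2)"
  unfolding has_critical_value_def
proof (intro conjI allI impI)
  fix \<beta> :: real assume \<beta>: "0 < \<beta> \<and> \<beta> < 1 / 2"
  let ?u = "\<lambda>n. ereal (H n x / real n powr \<beta>)"
  \<comment> \<open>The shortest windows known to contain a level word carry the most information
    relative to their length. The index starts at level 1 because \<open>l 0 = l 1\<close>.\<close>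
  define n where "n j = 2 * l (Suc j)" for j
  have "filterlim (\<lambda>j. H (2 * l j) x / real (2 * l j) powr \<beta>) at_top sequentially"
  proof (rule H_quotient_at_top[OF x, where A = 1])
    show "\<forall>\<^sub>F j in sequentially. 2 * l j \<le> 2 * l j \<and> 2 * l j \<le> l j * R j"
      using R_ge_2 by eventually_elim simp
  qed (use \<beta> in auto)
  then have "filterlim (\<lambda>j. H (n j) x / real (n j) powr \<beta>) at_top sequentially"
    unfolding n_def by (rule filterlim_compose[OF _ filterlim_Suc])
  then have "(?u \<circ> n) \<longlonglongrightarrow> \<infinity>" by (simp add: tendsto_PInfty_eq_at_top comp_def)
  then have "limsup (?u \<circ> n) = \<infinity>" by (intro lim_imp_Limsup) auto
  moreover have "strict_mono n"
    unfolding n_def strict_mono_Suc_iff using l_less_Suc by simp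
  then have "limsup (?u \<circ> n) \<le> limsup ?u" by (rule limsup_subseq_mono)
  ultimately show "limsup ?u = \<infinity>" by simp
next
  fix \<beta> :: real assume "1 / 2 < \<beta>"
  then have "(\<lambda>n. ereal (H n x / real n powr \<beta>)) \<longlonglongrightarrow> 0"
    using tendsto_ereal[OF H_quotient_long[OF x]] by (simp add: zero_ereal_def)
  then show "limsup (\<lambda>n. ereal (H n x / real n powr \<beta>)) = 0" by (intro lim_imp_Limsup) auto
qed

lemma critical_value_lim_shift:
  assumes "\<And>\<beta>. 0 < \<beta> \<Longrightarrow> \<beta> < c \<Longrightarrow> filterlim (\<lambda>j. H (n j) x / real (n j) powr \<beta>) at_top sequentially"
    and "\<And>\<beta>. c < \<beta> \<Longrightarrow> (\<lambda>j. H (n j) x / real (n j) powr \<beta>) \<longlonglongrightarrow> 0"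
  shows "has_critical_value_lim (\<lambda>\<beta> j. ereal (H (n (Suc j)) x / real (n (Suc j)) powr \<beta>)) c"
  unfolding has_critical_value_lim_def
proof (intro conjI allI impI)
  fix \<beta> :: real assume "0 < \<beta> \<and> \<beta> < c"
  then have "filterlim (\<lambda>j. H (n (Suc j)) x / real (n (Suc j)) powr \<beta>) at_top sequentially"
    using filterlim_compose[OF assms(1) filterlim_Suc] by blast
  then show "(\<lambda>j. ereal (H (n (Suc j)) x / real (n (Suc j)) powr \<beta>)) \<longlonglongrightarrow> \<infinity>"
    by (simp add: tendsto_PInfty_eq_at_top)
next
  fix \<beta> :: real assume "c < \<beta>"
  then show "(\<lambda>j. ereal (H (n (Suc j)) x / real (n (Suc j)) powr \<beta>)) \<longlonglongrightarrow> 0"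
    using tendsto_ereal[OF LIMSEQ_Suc[OF assms(2)]] by (simp add: zero_ereal_def)
qed

text \<open>On short windows the information is about \<open>l j powr (1 / 2)\<close>, whatever
  their length, so the critical value is \<open>\<tau>\<close> once \<open>n j\<close> is of order
  \<open>l j powr (1 / (2 * \<tau>))\<close>, and 0 once \<open>n j\<close> outgrows all powers of
  \<open>l j\<close>.\<close>

lemma critical_value_lim:
  assumes \<tau>: "\<tau> \<in> {0..1 / 2}"
  shows "\<exists>n. strict_mono n \<and> (\<forall>j. 0 < n j) \<and>
    (\<forall>x\<in>typical. has_critical_value_lim (\<lambda>\<beta> j. ereal (H (n j) x / real (n j) powr \<beta>)) \<tau>)"
proof (cases "\<tau> = 0")
  case True
  \<comment> \<open>The longest short windows; by \<open>l_powr_le_R\<close> they outgrow every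
    power of \<open>l j\<close>.\<close>
  define n where "n j = l j * R j" for j
  have "strict_mono (\<lambda>j. n (Suc j))"
    unfolding strict_mono_Suc_iff n_def
  proof
    fix j
    have "K (Suc j) \<le> K (Suc (Suc j))"
    proof -
      have "N (Suc j) \<le> N (Suc (Suc j))"
      proof -
        have "N (Suc j) < (K (Suc j) + 1) ^ 2" by (rule N_less_K)
        also have "\<dots> \<le> (K (Suc j) + 1) ^ 4" by (intro power_increasing) auto
        also have "\<dots> \<le> N (Suc (Suc j))"
          using power4_le_fact[of "K (Suc j)"] K_ge_8[OF N_ge_64[of "Suc j"]] by (simp add: N_Suc)
        finally show ?thesis by simp
      qed
      then show ?thesis unfolding K_def by (rule mono_floor_sqrt')
    qed
    then have "R (Suc j) \<le> R (Suc (Suc j))" unfolding R_def by (rule mono_floor_sqrt')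
    moreover have "l (Suc j) < l (Suc (Suc j))" by (rule l_less_Suc) simp
    ultimately show "l (Suc j) * R (Suc j) < l (Suc (Suc j)) * R (Suc (Suc j))"
      using R_pos[of "Suc j"] by (intro mult_less_le_imp_less) auto
  qed
  moreover have "0 < n (Suc j)" for j using l_pos[of "Suc j"] R_pos[of "Suc j"] by (simp add: n_def)
  moreover have "has_critical_value_lim (\<lambda>\<beta> j. ereal (H (n (Suc j)) x / real (n (Suc j)) powr \<beta>)) \<tau>"
    if x: "x \<in> typical" for x
  proof (rule critical_value_lim_shift)
    fix \<beta> assume \<beta>: "\<tau> < \<beta>"
    show "(\<lambda>j. H (n j) x / real (n j) powr \<beta>) \<longlonglongrightarrow> 0"
    \<comment> \<open>Any power may be used for \<open>A\<close>; this one gives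
      \<open>A * \<beta> = 1\<close>.\<close>
    proof (rule H_quotient_zero[OF x, where A = "1 / \<beta>"])
      show "\<forall>\<^sub>F j in sequentially. 2 * l j \<le> n j \<and> n j \<le> l j * R j"
        using R_ge_2 by eventually_elim (simp add: n_def)
      have "0 \<le> 1 / \<beta>" using \<beta> True by simp
      from l_powr_le_R[OF this] show "\<forall>\<^sub>F j in sequentially. real (l j) powr (1 / \<beta>) \<le> n j"
        using eventually_ge_at_top[of 1]
      proof eventually_elim
        case (elim j)
        have "1 * real (R j) \<le> real (l j) * R j" using l_pos[OF elim(2)] by (intro mult_right_mono) auto
        then show ?case using elim(1) by (simp add: n_def)
      qed
    qed (use \<beta> True in auto)
  qed (use True in auto)
  ultimately show ?thesis by (intro exI[of _ "\<lambda>j. n (Suc j)"]) blast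
next
  case False
  then have \<tau>: "0 < \<tau>" "\<tau> \<le> 1 / 2" using \<tau> by auto
  define A where "A = 1 / (2 * \<tau>)"
  \<comment> \<open>The assumption \<open>\<tau> \<le> 1 / 2\<close> enters here: the windows must
    be at least of order \<open>l j\<close>.\<close>
  have A: "1 \<le> A" using \<tau> by (simp add: A_def field_simps)
  \<comment> \<open>An integer of order \<open>l j powr A\<close> that is a positive multiple of
    \<open>2 * l j\<close> for \<open>j \<ge> 1\<close>. Rounding up at most doubles a number that
    is at least 1, whence the upper bound \<open>4 * l j powr A\<close>.\<close>
  define n where "n j = 2 * l j * nat \<lceil>real (l j) powr (A - 1)\<rceil>" for j
  have ceil_pos: "1 \<le> nat \<lceil>real (l j) powr (A - 1)\<rceil>" if "1 \<le> j" for j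
  proof -
    have "0 < real (l j) powr (A - 1)" using l_pos[OF that] by simp
    then have "0 < \<lceil>real (l j) powr (A - 1)\<rceil>" by simp
    then show ?thesis by linarith
  qed
  have bounds: "2 * l j \<le> n j \<and> 2 * real (l j) powr A \<le> n j \<and> n j \<le> 4 * real (l j) powr A" if j: "1 \<le> j" for j
  proof -
    have l1: "1 \<le> real (l j)" using l_pos[OF j] by simp
    let ?c = "real (nat \<lceil>real (l j) powr (A - 1)\<rceil>)"
    have p: "1 \<le> real (l j) powr (A - 1)" using l1 A by (intro ge_one_powr_ge_zero) auto
    have c: "real (l j) powr (A - 1) \<le> ?c" "?c \<le> 2 * real (l j) powr (A - 1)" using p by linarith+
    have lA: "real (l j) powr A = real (l j) * real (l j) powr (A - 1)"
      using l1 by (simp add: powr_diff)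
    have n: "real (n j) = 2 * real (l j) * ?c" by (simp add: n_def)
    have "real (l j) * real (l j) powr (A - 1) \<le> real (l j) * ?c"
      "real (l j) * ?c \<le> real (l j) * (2 * real (l j) powr (A - 1))"
      using c by (intro mult_left_mono; simp)+
    then have "2 * real (l j) powr A \<le> n j" "n j \<le> 4 * real (l j) powr A"
      unfolding n lA by linarith+
    moreover have "2 * l j * 1 \<le> n j" unfolding n_def using ceil_pos[OF j] by (intro mult_le_mono) auto
    ultimately show ?thesis by simp
  qed
  have ev_bounds: "\<forall>\<^sub>F j in sequentially. 2 * l j \<le> n j \<and> 2 * real (l j) powr A \<le> n j \<and> n j \<le> 4 * real (l j) powr A"
    using eventually_ge_at_top[of 1] by eventually_elim (rule bounds)
  have "0 \<le> A + 1" using A by simp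
  from l_powr_le_R[OF this] ev_bounds eventually_ge_at_top[of 1]
  have window: "\<forall>\<^sub>F j in sequentially. 2 * l j \<le> n j \<and> n j \<le> l j * R j"
  proof eventually_elim
    case (elim j)
    have l3: "3 \<le> real (l j)" using l_ge_3[OF elim(3)] by simp
    \<comment> \<open>The factor 4 is absorbed by \<open>l j ^ 2 \<ge> 9\<close>; one factor
      \<open>l j\<close> goes into the exponent \<open>A + 1\<close>, the other remains for
      \<open>l j * R j\<close>.\<close>
    have "3 * 3 \<le> real (l j) * real (l j)" using l3 by (intro mult_mono) auto
    then have "4 * real (l j) powr A \<le> (real (l j) * real (l j)) * real (l j) powr A"
      by (intro mult_right_mono) auto
    also have "\<dots> = real (l j) * real (l j) powr (A + 1)" using l3 by (simp add: powr_add)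
    also have "\<dots> \<le> real (l j) * R j" using elim(1) by (intro mult_left_mono) auto
    finally have "real (n j) \<le> real (l j * R j)" using elim(2) by simp
    then show ?case using elim(2) by (simp only: of_nat_le_iff)
  qed
  have "strict_mono (\<lambda>j. n (Suc j))"
    unfolding strict_mono_Suc_iff n_def
  proof
    fix j
    have l: "l (Suc j) < l (Suc (Suc j))" by (rule l_less_Suc) simp
    then have "real (l (Suc j)) powr (A - 1) \<le> real (l (Suc (Suc j))) powr (A - 1)"
      using A by (intro powr_mono2) auto
    then have "nat \<lceil>real (l (Suc j)) powr (A - 1)\<rceil> \<le> nat \<lceil>real (l (Suc (Suc j))) powr (A - 1)\<rceil>"
      by (intro nat_mono ceiling_mono)
    then show "2 * l (Suc j) * nat \<lceil>real (l (Suc j)) powr (A - 1)\<rceil>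
        < 2 * l (Suc (Suc j)) * nat \<lceil>real (l (Suc (Suc j))) powr (A - 1)\<rceil>"
    proof (rule mult_less_le_imp_less[rotated])
      show "0 < nat \<lceil>real (l (Suc j)) powr (A - 1)\<rceil>" using ceil_pos[of "Suc j"] by linarith
    qed (use l in simp_all)
  qed
  moreover have "0 < n (Suc j)" for j using bounds[of "Suc j"] l_pos[of "Suc j"] by simp
  moreover have "has_critical_value_lim (\<lambda>\<beta> j. ereal (H (n (Suc j)) x / real (n (Suc j)) powr \<beta>)) \<tau>"
    if x: "x \<in> typical" for x
  proof (rule critical_value_lim_shift)
    fix \<beta> assume \<beta>: "0 < \<beta>" "\<beta> < \<tau>"
    show "filterlim (\<lambda>j. H (n j) x / real (n j) powr \<beta>) at_top sequentially"
    proof (rule H_quotient_at_top[OF x \<beta>(1) _ _ window])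
      show "A * \<beta> < 1 / 2" using \<beta> \<tau> by (simp add: A_def field_simps)
    qed (use A ev_bounds in \<open>auto elim: eventually_mono\<close>)
  next
    fix \<beta> assume \<beta>: "\<tau> < \<beta>"
    show "(\<lambda>j. H (n j) x / real (n j) powr \<beta>) \<longlonglongrightarrow> 0"
    proof (rule H_quotient_zero[OF x _ _ window])
      show "1 / 2 < A * \<beta>" using \<beta> \<tau> by (simp add: A_def field_simps)
      show "\<forall>\<^sub>F j in sequentially. real (l j) powr A \<le> n j"
        using ev_bounds by eventually_elim (smt (verit) powr_ge_zero)
    qed (use \<beta> \<tau> in auto)
  qed
  ultimately show ?thesis by (intro exI[of _ "\<lambda>j. n (Suc j)"]) blast
qed

end

theorem theorem4p4:
  "\<exists>L::nat. \<forall>l1 C. L \<le> l1 \<and> marker_construction l1 C \<longrightarrow>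
     (\<forall>M :: (int \<Rightarrow> nat) measure.
        prob_space M \<and> sets M = sets borel \<and>
        emeasure M (marker_shift C) = 1 \<and>
        (\<forall>A \<in> sets M. emeasure M (shift_map -` A) = emeasure M A) \<longrightarrow>
        (AE x in M. has_critical_value
            (\<lambda>\<beta>. limsup (\<lambda>n. ereal (- ln (measure M (cyl (marker_shift C) n x)) / real n powr \<beta>)))
            (1/2)) \<and>
        (\<exists>Xh. Xh \<subseteq> marker_shift C \<and> Xh \<in> sets M \<and> emeasure M Xh = 1 \<and>
           (\<forall>\<tau> \<in> {0..1/2}. \<exists>nj :: nat \<Rightarrow> nat. strict_mono nj \<and> (\<forall>j. 0 < nj j) \<and>
              (\<forall>x \<in> Xh. has_critical_value_lim
                 (\<lambda>\<beta> j. ereal (- ln (measure M (cyl (marker_shift C) (nj j) x)) / real (nj j) powr \<beta>))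
                 \<tau>))))"
proof (intro exI[of _ 36] allI impI)
  fix l1 C and M :: "(int \<Rightarrow> nat) measure"
  assume C: "36 \<le> l1 \<and> marker_construction l1 C"
    and M: "prob_space M \<and> sets M = sets borel \<and> emeasure M (marker_shift C) = 1 \<and>
      (\<forall>A \<in> sets M. emeasure M (shift_map -` A) = emeasure M A)"
  interpret prob_space M using M by blast
  interpret marker_measure l1 C M
    by unfold_locales (use C M in auto)
  show "(AE x in M. has_critical_value
            (\<lambda>\<beta>. limsup (\<lambda>n. ereal (- ln (measure M (cyl (marker_shift C) n x)) / real n powr \<beta>)))
            (1/2)) \<and>
        (\<exists>Xh. Xh \<subseteq> marker_shift C \<and> Xh \<in> sets M \<and> emeasure M Xh = 1 \<and>
           (\<forall>\<tau> \<in> {0..1/2}. \<exists>nj :: nat \<Rightarrow> nat. strict_mono nj \<and> (\<forall>j. 0 < nj j) \<and>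
              (\<forall>x \<in> Xh. has_critical_value_lim
                 (\<lambda>\<beta> j. ereal (- ln (measure M (cyl (marker_shift C) (nj j) x)) / real (nj j) powr \<beta>))
                 \<tau>)))"
    unfolding H_def[symmetric]
  proof (intro conjI exI[of _ typical] ballI)
    show "AE x in M. has_critical_value (\<lambda>\<beta>. limsup (\<lambda>n. ereal (H n x / real n powr \<beta>))) (1/2)"
      using AE_typical by eventually_elim (rule critical_value_limsup)
  qed (use typical_X typical_sets emeasure_typical critical_value_lim in auto)
qed

end
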